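(* Let $k\ge 2$ be an integer and $n=k+2^k$. Define the Double-Indexing function $\mathsf{DI}$ as follows: Alice's input is a pair $(i,x)$ and Bob's input is a pair $(j,y)$ with $i,j\in[2^k]$ and $x,y\in\{\pm1\}^{2^k}$, and $\mathsf{DI}((i,x),(j,y))=x_j y_i$. Then for every $\varepsilon\ge 2/n$, $\bar{\mathrm{R}}_\varepsilon(\mathsf{DI})=\Omega(1/\varepsilon^2)$.
   Context: Distributed estimation of a function $f:\mathcal{X}\times\mathcal{Y}\to[-1,1]$: Alice holds a probability distribution $p$ on $\mathcal{X}$, Bob holds a probability distribution $q$ on $\mathcal{Y}$, and they must output an estimate of $\mathbb{E}_{x\sim p,y\sim q}[f(x,y)]$ within additive error $\varepsilon$. $\bar{\mathrm{R}}_\varepsilon(f)$ is the minimum worst-case communication (in bits) of a shared-randomness randomized protocol that, for every input pair $(p,q)$, succeeds with probability at least $2/3$. $\Omega$ hides an absolute constant.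
   Formalization: The bound is proved for 2/n ≤ ε < 1; for ε ≥ 1 it fails as written, because always outputting 0 is within error ε without any communication, so the communication cost is 0. *)

theory Defs
  imports "HOL-Probability.Probability"
begin

text \<open>
  Deterministic two-party protocols: every inner node is owned by one player, who sends the bit
  obtained by applying the predicate at the node to that player's own input; the play moves to the
  first subtree if the bit is 1 and to the second one otherwise.
\<close>

datatype ('a, 'b, 'r) protocol =
    Output 'r
  | Alice "'a \<Rightarrow> bool" "('a, 'b, 'r) protocol" "('a, 'b, 'r) protocol"
  | Bob "'b \<Rightarrow> bool" "('a, 'b, 'r) protocol" "('a, 'b, 'r) protocol"

primrec run :: "('a, 'b, 'r) protocol \<Rightarrow> 'a \<Rightarrow> 'b \<Rightarrow> 'r" where
  "run (Output r) a b = r"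
| "run (Alice g s t) a b = (if g a then run s a b else run t a b)"
| "run (Bob g s t) a b = (if g b then run s a b else run t a b)"

primrec depth :: "('a, 'b, 'r) protocol \<Rightarrow> nat" where
  "depth (Output r) = 0"
| "depth (Alice g s t) = Suc (max (depth s) (depth t))"
| "depth (Bob g s t) = Suc (max (depth s) (depth t))"

text \<open>
  A shared-randomness protocol is a probability measure on deterministic protocols. Its
  sigma-algebra is arbitrary, so this covers every family of deterministic protocols indexed by an
  arbitrary probability space (push the measure forward along the family). A non-measurable set has
  \<open>measure\<close> 0, so the success condition below includes measurability of the success event.
\<close>

definition worst_case_cost :: "('a, 'b, 'r) protocol measure \<Rightarrow> enat" where
  "worst_case_cost M = (SUP \<pi>\<in>space M. enat (depth \<pi>))"

definition estimates ::
  "real \<Rightarrow> 'x set \<Rightarrow> 'y set \<Rightarrow> ('x \<Rightarrow> 'y \<Rightarrow> real) \<Rightarrow> ('x pmf, 'y pmf, real) protocol measure \<Rightarrow> bool"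
where
  "estimates \<epsilon> X Y f M \<longleftrightarrow> prob_space M \<and>
     (\<forall>p q. set_pmf p \<subseteq> X \<longrightarrow> set_pmf q \<subseteq> Y \<longrightarrow>
        measure M {\<pi> \<in> space M.
            \<bar>run \<pi> p q - measure_pmf.expectation (pair_pmf p q) (\<lambda>(x, y). f x y)\<bar> \<le> \<epsilon>} \<ge> 2 / 3)"

definition Rbar :: "real \<Rightarrow> 'x set \<Rightarrow> 'y set \<Rightarrow> ('x \<Rightarrow> 'y \<Rightarrow> real) \<Rightarrow> enat" where
  "Rbar \<epsilon> X Y f = (INF M\<in>{M. estimates \<epsilon> X Y f M}. worst_case_cost M)"

definition DI_inputs :: "nat \<Rightarrow> (nat \<times> (nat \<Rightarrow> real)) set" where
  "DI_inputs k = {1..2 ^ k} \<times> ({1..2 ^ k} \<rightarrow>\<^sub>E {- 1, 1})"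

definition DI :: "nat \<times> (nat \<Rightarrow> real) \<Rightarrow> nat \<times> (nat \<Rightarrow> real) \<Rightarrow> real" where
  "DI = (\<lambda>(i, x) (j, y). x j * y i)"

text \<open>
  At \<open>\<epsilon> \<ge> 1\<close> the constant estimate 0 is always correct, so no positive lower bound can hold there.
\<close>

lemma Rbar_eq_0:
  assumes f: "\<And>x y. x \<in> X \<Longrightarrow> y \<in> Y \<Longrightarrow> \<bar>f x y\<bar> \<le> 1" and "1 \<le> \<epsilon>"
  shows "Rbar \<epsilon> X Y f = 0"
proof -
  define M :: "('a pmf, 'b pmf, real) protocol measure"
    where "M = return (count_space {Output 0}) (Output 0)"
  have sp: "space M = {Output 0}" by (simp add: M_def)
  have M: "prob_space M" unfolding M_def by (rule prob_space_return) simp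
  have "estimates \<epsilon> X Y f M"
    unfolding estimates_def
  proof (intro conjI allI impI M)
    fix p q assume p: "set_pmf p \<subseteq> X" and q: "set_pmf q \<subseteq> Y"
    let ?E = "measure_pmf.expectation (pair_pmf p q) (\<lambda>(x, y). f x y)"
    have AE: "AE z in measure_pmf (pair_pmf p q). \<bar>(\<lambda>(x, y). f x y) z\<bar> \<le> 1"
      using f p q by (fastforce simp: AE_measure_pmf_iff)
    have int: "integrable (measure_pmf (pair_pmf p q)) (\<lambda>(x, y). f x y)"
      by (rule measure_pmf.integrable_const_bound[where B = 1]) (use AE in auto)
    have "?E \<le> 1"
      by (rule measure_pmf.integral_le_const[OF int]) (use AE in \<open>auto elim!: eventually_mono\<close>)
    moreover have "- 1 \<le> ?E"
      by (rule measure_pmf.integral_ge_const[OF int]) (use AE in \<open>auto elim!: eventually_mono\<close>)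
    ultimately have "{\<pi> \<in> space M. \<bar>run \<pi> p q - ?E\<bar> \<le> \<epsilon>} = space M"
      using \<open>1 \<le> \<epsilon>\<close> by (auto simp: sp)
    then show "2 / 3 \<le> measure M {\<pi> \<in> space M. \<bar>run \<pi> p q - ?E\<bar> \<le> \<epsilon>}"
      using prob_space.prob_space[OF M] by simp
  qed
  then have "Rbar \<epsilon> X Y f \<le> worst_case_cost M"
    unfolding Rbar_def by (intro INF_lower) simp
  also have "\<dots> = 0" by (simp add: worst_case_cost_def sp zero_enat_def)
  finally show ?thesis by simp
qed

end

theory Submission imports Defs begin

text \<open>
  The Double-Indexing expectation contains the normalised inner product of two \<open>r \<times> r\<close> matrices with
  entries in \<open>[-1, 1]\<close>, for every \<open>r \<le> 2 ^ k\<close>. With \<open>m = r\<^sup>2\<close> and \<open>r\<close> a small multiple of \<open>1 / \<epsilon>\<close>, a correct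
  estimate determines the inner product up to a small multiple of its standard deviation, as in the
  gap orthogonality problem.

  Alice's vector \<open>x\<close> is a random sign vector; each coordinate of Bob's vector \<open>y\<close> is a sum of \<open>m\<close> random
  signs, which makes its characteristic function Gaussian on the relevant range. On a rectangle
  \<open>S \<times> T\<close> of density at least \<open>exp (- c m)\<close>, no value \<open>v\<close> is correct on more than a fraction
  \<open>65/100\<close>: otherwise one picks greedily \<open>a\<close> vectors of \<open>S\<close>, where \<open>a\<close> is a small multiple of \<open>m\<close>, each far
  from the span of its predecessors (all but exponentially few vectors are) and each keeping a fraction
  \<open>62/100\<close> of the surviving \<open>y\<close>. A Fourier estimate shows that only a fraction of about \<open>(52/100) ^ a\<close> of
  all \<open>y\<close> has almost the same inner product with all of them, so \<open>T\<close> was too small. A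
  deterministic protocol of depth \<open>D\<close> splits the inputs into \<open>2 ^ D\<close> rectangles, and therefore succeeding
  on two thirds of the inputs forces \<open>D\<close> to be of order \<open>m\<close>.
\<close>

section \<open>Sums over sign vectors\<close>

lemma cosh_le_exp_half_square: "cosh (t::real) \<le> exp (t\<^sup>2 / 2)"
proof -
  \<comment> \<open>Since \<open>ln (cosh t)\<close> has derivative \<open>tanh t\<close>, the claim
    is the integral of \<open>tanh t <= t\<close>. Both sides are even, so \<open>t >= 0\<close>
    suffices.\<close>
  have mono: "t - tanh t \<ge> 0" if "t \<ge> 0" for t :: real
  proof -
    have "(\<lambda>t. t - tanh t) 0 \<le> (\<lambda>t::real. t - tanh t) t"
      using that
      by (rule DERIV_nonneg_imp_nondecreasing)
         (auto intro!: derivative_eq_intros simp: power2_eq_square)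
    then show ?thesis by simp
  qed
  have *: "cosh t \<le> exp (t\<^sup>2 / 2)" if "t \<ge> 0" for t :: real
  proof -
    have "(\<lambda>t. t\<^sup>2 / 2 - ln (cosh t)) 0 \<le> (\<lambda>t::real. t\<^sup>2 / 2 - ln (cosh t)) t"
      using that
    proof (rule DERIV_nonneg_imp_nondecreasing)
      fix x :: real assume "0 \<le> x"
      have "((\<lambda>t. t\<^sup>2 / 2 - ln (cosh t)) has_real_derivative x - tanh x) (at x)"
        by (auto intro!: derivative_eq_intros simp: tanh_def)
      then show "\<exists>y. ((\<lambda>t. t\<^sup>2 / 2 - ln (cosh t)) has_real_derivative y) (at x) \<and> 0 \<le> y"
        using mono[OF \<open>0 \<le> x\<close>] by blast
    qed
    then have "ln (cosh t) \<le> t\<^sup>2 / 2" by simp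
    then show ?thesis by (metis cosh_real_pos exp_le_cancel_iff exp_ln)
  qed
  show ?thesis using *[of "\<bar>t\<bar>"] by (cases "t \<ge> 0") (auto simp: abs_if)
qed

lemma cos_ge_one_minus: "cos (x::real) \<ge> 1 - x\<^sup>2 / 2"
proof -
  have "cos x = 1 - 2 * (sin (x / 2))\<^sup>2" using cos_double_sin[of "x / 2"] by simp
  moreover have "(sin (x / 2))\<^sup>2 \<le> (x / 2)\<^sup>2"
    using abs_sin_x_le_abs_x[of "x / 2"] abs_le_square_iff by blast
  ultimately show ?thesis by (simp add: power2_eq_square)
qed

text \<open>The half-angle formula and \<open>sin s >= 7/8 * s\<close> on \<open>[0, 1/2]\<close>
  give \<open>cos z <= 1 - z^2 / 4\<close>. The range \<open>[-1, 1]\<close> is the source of the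
  bound on \<open>z\<close> in \<open>fourier_decay\<close>.\<close>

lemma abs_cos_le_exp:
  assumes "\<bar>z::real\<bar> \<le> 1"
  shows "\<bar>cos z\<bar> \<le> exp (- (z\<^sup>2 / 4))"
proof -
  have sin: "(sin s)\<^sup>2 \<ge> s\<^sup>2 / 2" if "0 \<le> s" "s \<le> 1 / 2" for s :: real
  proof (cases "s = 0")
    case False
    then have "0 < s" using that by simp
    then obtain \<xi> where \<xi>: "0 < \<xi>" "\<xi> < s" "sin s - sin 0 = (s - 0) * cos \<xi>"
      using MVT2[of 0 s sin cos] by (auto intro: DERIV_sin)
    have "\<xi>\<^sup>2 \<le> (1/2)\<^sup>2" using \<xi> that by (intro power_mono) auto
    then have "cos \<xi> \<ge> 7 / 8" using cos_ge_one_minus[of \<xi>] by (simp add: power2_eq_square)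
    then have "sin s \<ge> s * (7 / 8)" using \<xi> \<open>0 < s\<close> by (simp add: mult_left_mono)
    then have "(sin s)\<^sup>2 \<ge> (s * (7 / 8))\<^sup>2" using \<open>0 < s\<close> by (intro power_mono) auto
    moreover have "(s * (7 / 8))\<^sup>2 \<ge> s\<^sup>2 / 2" by (simp add: power2_eq_square)
    ultimately show ?thesis by linarith
  qed simp
  have "(sin \<bar>z / 2\<bar>)\<^sup>2 \<ge> \<bar>z / 2\<bar>\<^sup>2 / 2" using assms by (intro sin) auto
  then have "(sin (z / 2))\<^sup>2 \<ge> z\<^sup>2 / 8"
    by (auto simp: abs_if power2_eq_square split: if_splits)
  moreover have "cos z = 1 - 2 * (sin (z / 2))\<^sup>2" using cos_double_sin[of "z / 2"] by simp
  ultimately have "cos z \<le> 1 + - (z\<^sup>2 / 4)" by simp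
  also have "\<dots> \<le> exp (- (z\<^sup>2 / 4))" by (rule exp_ge_add_one_self)
  finally have 1: "cos z \<le> exp (- (z\<^sup>2 / 4))" .
  have "z\<^sup>2 \<le> 1" using assms by (simp add: abs_square_le_1)
  then have "cos z \<ge> 0" using cos_ge_one_minus[of z] by simp
  with 1 show ?thesis by simp
qed

section \<open>Inner products and generating functions of sign vectors\<close>

definition ip :: "nat \<Rightarrow> (nat \<Rightarrow> real) \<Rightarrow> (nat \<Rightarrow> real) \<Rightarrow> real" where
  "ip m u v = (\<Sum>b<m. u b * v b)"

lemma ip_commute: "ip m u v = ip m v u"
  by (simp add: ip_def mult.commute)

lemma ip_add_left: "ip m (\<lambda>b. u b + w b) v = ip m u v + ip m w v"
  by (simp add: ip_def algebra_simps sum.distrib)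

lemma ip_scale_left: "ip m (\<lambda>b. c * u b) v = c * ip m u v"
  by (simp add: ip_def sum_distrib_left algebra_simps)

lemma ip_add_right: "ip m v (\<lambda>b. u b + w b) = ip m v u + ip m v w"
  by (simp add: ip_def algebra_simps sum.distrib)

lemma ip_scale_right: "ip m v (\<lambda>b. c * u b) = c * ip m v u"
  by (simp add: ip_def sum_distrib_left algebra_simps)

lemma ip_sum_left: "ip m (\<lambda>b. \<Sum>l\<in>A. f l b) v = (\<Sum>l\<in>A. ip m (f l) v)"
  unfolding ip_def sum_distrib_right by (rule sum.swap)

lemmas ip_bilinear = ip_add_left ip_add_right ip_scale_left ip_scale_right

definition signs :: "nat \<Rightarrow> (nat \<Rightarrow> real) set" where
  "signs m = {..<m} \<rightarrow>\<^sub>E {- 1, 1}"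

lemma finite_signs [simp]: "finite (signs m)"
  by (simp add: signs_def finite_PiE)

lemma card_signs: "card (signs m) = 2 ^ m"
  by (simp add: signs_def card_funcsetE numeral_2_eq_2)

lemma signs_apply: "x \<in> signs m \<Longrightarrow> b < m \<Longrightarrow> x b = -1 \<or> x b = 1"
  by (auto simp: signs_def PiE_iff)

lemma ip_signs: "x \<in> signs m \<Longrightarrow> ip m x x = real m"
proof -
  assume "x \<in> signs m"
  then have "ip m x x = (\<Sum>b<m. 1)"
    unfolding ip_def by (intro sum.cong) (use signs_apply in fastforce)+
  then show ?thesis by simp
qed

text \<open>Independence of the coordinates. The codomain is general because both real exponentials
  and complex characters are summed below.\<close>

lemma sum_signs_prod:
  fixes f :: "nat \<Rightarrow> real \<Rightarrow> 'c::{comm_semiring_1}"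
  shows "(\<Sum>x\<in>signs m. \<Prod>b<m. f b (x b)) = (\<Prod>b<m. f b (- 1) + f b 1)"
  unfolding signs_def by (subst prod_sum_PiE[symmetric]) auto

text \<open>The moment generating function factorises into \<open>cosh (w b)\<close>, so a uniform
  sign vector is sub-Gaussian.\<close>

lemma sum_signs_exp_le:
  "(\<Sum>x\<in>signs m. exp (ip m w x)) \<le> 2 ^ m * exp (ip m w w / 2)"
proof -
  have "(\<Sum>x\<in>signs m. exp (ip m w x)) = (\<Sum>x\<in>signs m. \<Prod>b<m. exp (w b * x b))"
    by (simp add: ip_def exp_sum)
  also have "\<dots> = (\<Prod>b<m. 2 * cosh (w b))"
    by (subst sum_signs_prod) (simp add: cosh_field_def add_divide_distrib add.commute)
  also have "\<dots> \<le> (\<Prod>b<m. 2 * exp ((w b)\<^sup>2 / 2))"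
    by (intro prod_mono conjI mult_left_mono cosh_le_exp_half_square) auto
  also have "\<dots> = 2 ^ m * exp (ip m w w / 2)"
    by (simp add: prod.distrib ip_def exp_sum[symmetric] sum_divide_distrib power2_eq_square)
  finally show ?thesis .
qed

text \<open>Bob's random vector: coordinate \<open>b\<close> is the sum of the signs in row
  \<open>b\<close> of a uniform array \<open>\<omega>\<close>. Counting arrays instead of values
  makes every probability a ratio of cardinalities.\<close>

definition row_sums :: "nat \<Rightarrow> (nat \<Rightarrow> nat \<Rightarrow> real) \<Rightarrow> nat \<Rightarrow> real" where
  "row_sums m \<omega> b = (\<Sum>l<m. \<omega> b l)"

definition sign_arrays :: "nat \<Rightarrow> (nat \<Rightarrow> nat \<Rightarrow> real) set" where
  "sign_arrays m = {..<m} \<rightarrow>\<^sub>E signs m"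

lemma finite_sign_arrays [simp]: "finite (sign_arrays m)"
  by (simp add: sign_arrays_def finite_PiE)

lemma card_sign_arrays: "card (sign_arrays m) = (2 ^ m) ^ m"
  by (simp add: sign_arrays_def card_funcsetE card_signs)

lemma sum_cis_signs: "(\<Sum>x\<in>signs m. cis (t * (\<Sum>l<m. x l))) = of_real (2 * cos t) ^ m"
proof -
  have "cis (t * (\<Sum>l<m. x l)) = (\<Prod>l<m. cis (t * x l))" for x :: "nat \<Rightarrow> real"
    by (induction m) (simp_all add: algebra_simps flip: cis_mult)
  then have "(\<Sum>x\<in>signs m. cis (t * (\<Sum>l<m. x l))) = (\<Prod>l<m. cis (- t) + cis t)"
    by (simp add: sum_signs_prod[where f = "\<lambda>_ y. cis (t * y)"])
  also have "cis (- t) + cis t = of_real (2 * cos t)"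
    by (simp add: complex_eq_iff)
  finally show ?thesis by simp
qed

text \<open>The characteristic function of the row sums is the product of the
  \<open>cos (z b) ^ m\<close>. Its Gaussian bound starts the induction on
  \<open>fourier_decay\<close>.\<close>

lemma norm_sum_cis_le:
  assumes "\<And>b. b < m \<Longrightarrow> \<bar>z b\<bar> \<le> 1"
  shows "norm (\<Sum>\<omega>\<in>sign_arrays m. cis (ip m z (row_sums m \<omega>)))
           \<le> real (card (sign_arrays m)) * exp (- (real m / 4 * ip m z z))"
proof -
  have cis_sum: "cis (\<Sum>b<k. f b) = (\<Prod>b<k. cis (f b))" for f and k :: nat
    by (induction k) (simp_all flip: cis_mult)
  have "(\<Sum>\<omega>\<in>sign_arrays m. cis (ip m z (row_sums m \<omega>)))
      = (\<Sum>\<omega>\<in>sign_arrays m. \<Prod>b<m. cis (z b * (\<Sum>l<m. \<omega> b l)))"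
    by (simp add: ip_def row_sums_def cis_sum)
  also have "\<dots> = (\<Prod>b<m. \<Sum>x\<in>signs m. cis (z b * (\<Sum>l<m. x l)))"
    unfolding sign_arrays_def by (subst prod_sum_PiE) auto
  also have "\<dots> = (\<Prod>b<m. of_real (2 * cos (z b)) ^ m)"
    by (simp only: sum_cis_signs)
  finally have "norm (\<Sum>\<omega>\<in>sign_arrays m. cis (ip m z (row_sums m \<omega>)))
      = (\<Prod>b<m. (2 * \<bar>cos (z b)\<bar>) ^ m)"
    by (simp add: norm_power norm_mult flip: prod_norm)
  also have "\<dots> \<le> (\<Prod>b<m. (2 * exp (- ((z b)\<^sup>2 / 4))) ^ m)"
    by (intro prod_mono conjI power_mono mult_left_mono abs_cos_le_exp assms) auto
  also have "\<dots> = (2 ^ m) ^ m * (\<Prod>b<m. exp (- (real m / 4 * (z b)\<^sup>2)))"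
    by (simp add: power_mult_distrib prod.distrib flip: exp_of_nat_mult)
  also have "(\<Prod>b<m. exp (- (real m / 4 * (z b)\<^sup>2))) = exp (- (real m / 4 * ip m z z))"
    by (simp add: ip_def sum_distrib_left power2_eq_square sum_negf flip: exp_sum)
  finally show ?thesis by (simp add: card_sign_arrays)
qed

section \<open>Sign vectors close to a low-dimensional subspace\<close>

definition orthonormal :: "nat \<Rightarrow> nat \<Rightarrow> (nat \<Rightarrow> nat \<Rightarrow> real) \<Rightarrow> bool" where
  "orthonormal m d e \<longleftrightarrow> (\<forall>l<d. \<forall>l'<d. ip m (e l) (e l') = of_bool (l = l'))"

text \<open>One Gram-Schmidt step; \<open>q\<close> is the squared distance from \<open>x\<close> to
  the span of the first \<open>d\<close> vectors. The last conclusion lets the distance to the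
  enlarged span be computed later.\<close>

lemma orthonormal_extend:
  assumes e: "orthonormal m d e" and q: "q = ip m x x - (\<Sum>l<d. (ip m (e l) x)\<^sup>2)" "q > 0"
  obtains e' where "orthonormal m (Suc d) e'" "\<And>l. l < d \<Longrightarrow> e' l = e l"
    "\<And>z. ip m (e' d) z = (ip m x z - (\<Sum>l<d. ip m (e l) x * ip m (e l) z)) / sqrt q"
proof
  define h where "h = (\<lambda>b. 1 / sqrt q * (x b + (-1) * (\<Sum>l<d. ip m (e l) x * e l b)))"
  define e' where "e' = e(d := h)"
  show "e' l = e l" if "l < d" for l using that by (simp add: e'_def)
  have h: "ip m h z = (ip m x z - (\<Sum>l<d. ip m (e l) x * ip m (e l) z)) / sqrt q" for z
    unfolding h_def ip_bilinear ip_sum_left by simp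
  show "ip m (e' d) z = (ip m x z - (\<Sum>l<d. ip m (e l) x * ip m (e l) z)) / sqrt q" for z
    by (simp add: e'_def h)
  have he: "ip m h (e l) = 0" if "l < d" for l
  proof -
    have "(\<Sum>l'<d. ip m (e l') x * ip m (e l') (e l)) = (\<Sum>l'<d. if l' = l then ip m (e l') x else 0)"
      using e that by (intro sum.cong) (auto simp: orthonormal_def)
    then show ?thesis using that by (simp add: h ip_commute[of m x])
  qed
  then have eh: "ip m (e l) h = 0" if "l < d" for l
    using that by (simp add: ip_commute[of m "e l"])
  \<comment> \<open>Only the second argument is expanded: \<open>h\<close> is orthogonal to every
    \<open>e l\<close>, and \<open>ip m h x = sqrt q\<close>.\<close>
  have "ip m h h = ip m h (\<lambda>b. 1 / sqrt q * (x b + (-1) * (\<Sum>l<d. ip m (e l) x * e l b)))"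
    by (simp add: h_def)
  also have "\<dots> = 1 / sqrt q * (ip m h x - (\<Sum>l<d. ip m (e l) x * ip m (e l) h))"
    unfolding ip_bilinear ip_commute[of m h "\<lambda>b. \<Sum>l<d. _ l * _ l b"] ip_sum_left by simp
  also have "\<dots> = 1 / sqrt q * ip m h x"
    using eh by simp
  also have "\<dots> = 1"
    using q by (simp add: h power2_eq_square)
  finally have "ip m h h = 1" .
  then show "orthonormal m (Suc d) e'"
    using e he eh by (auto simp: orthonormal_def e'_def less_Suc_eq)
qed

text \<open>
  A discrete substitute for the Gaussian identity \<open>E exp (g u) = exp (u\<^sup>2 / 2)\<close>: it linearises the
  squared projections \<open>(ip m (e l) x)\<^sup>2\<close> in the exponent, so that the average over \<open>x\<close> factorises.
\<close>

lemma exp_sq_le_lattice_sum: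
  fixes u :: real
  assumes "\<bar>u\<bar> \<le> real M" "M \<ge> 1"
  shows "exp (u\<^sup>2 / 4 - 1 / 4) \<le> (\<Sum>g\<in>{- int M..int M}. exp (- (real_of_int g)\<^sup>2 + real_of_int g * u))"
proof -
  \<comment> \<open>The integer nearest to \<open>u / 2\<close> nearly maximises the exponent, which
    is \<open>u^2 / 4 - (g - u / 2)^2\<close>.\<close>
  define g where "g = round (u / 2)"
  have g: "\<bar>real_of_int g - u / 2\<bar> \<le> 1 / 2"
    unfolding g_def by (rule of_int_round_abs_le)
  then have "(real_of_int g - u / 2)\<^sup>2 \<le> (1 / 2)\<^sup>2"
    by (metis abs_le_square_iff abs_of_nonneg zero_le_divide_1_iff zero_le_numeral)
  then have "u\<^sup>2 / 4 - 1 / 4 \<le> - (real_of_int g)\<^sup>2 + real_of_int g * u"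
    by (simp add: power2_eq_square algebra_simps)
  then have "exp (u\<^sup>2 / 4 - 1 / 4) \<le> exp (- (real_of_int g)\<^sup>2 + real_of_int g * u)" by simp
  also have "\<dots> \<le> (\<Sum>g\<in>{- int M..int M}. exp (- (real_of_int g)\<^sup>2 + real_of_int g * u))"
  proof (rule member_le_sum)
    have "\<bar>real_of_int g\<bar> \<le> real M" using g assms by linarith
    then show "g \<in> {- int M..int M}" by auto
  qed auto
  finally show ?thesis .
qed

text \<open>Comparison with the two-sided geometric series of ratio 2/3, whose total is 5.\<close>

lemma lattice_sum_le: "(\<Sum>g\<in>{- int M..int M}. exp (- (real_of_int g)\<^sup>2 / 2)) \<le> 5"
proof -
  have half: "exp (- (1 / 2) :: real) \<le> 2 / 3"
    using exp_ge_add_one_self[of "1 / 2 :: real"] by (simp add: exp_minus field_simps)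
  have "exp (- (real_of_int g)\<^sup>2 / 2) \<le> (2 / 3) ^ nat \<bar>g\<bar>" for g :: int
  proof -
    have "\<bar>g\<bar> * 1 \<le> \<bar>g\<bar> * \<bar>g\<bar>"
      by (cases "g = 0") (simp, intro mult_left_mono, auto)
    then have "real_of_int \<bar>g\<bar> \<le> (real_of_int g)\<^sup>2"
      by (metis abs_mult_self_eq mult.right_neutral of_int_le_iff of_int_power power2_eq_square)
    then have "exp (- (real_of_int g)\<^sup>2 / 2) \<le> exp (real (nat \<bar>g\<bar>) * - (1 / 2))" by simp
    also have "\<dots> = exp (- (1 / 2)) ^ nat \<bar>g\<bar>" by (rule exp_of_nat_mult)
    also have "\<dots> \<le> (2 / 3) ^ nat \<bar>g\<bar>" using half by (intro power_mono) auto
    finally show ?thesis .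
  qed
  then have "(\<Sum>g\<in>{- int M..int M}. exp (- (real_of_int g)\<^sup>2 / 2)) \<le> (\<Sum>g\<in>{- int M..int M}. (2 / 3) ^ nat \<bar>g\<bar>)"
    by (intro sum_mono)
  also have "\<dots> = 5 - 4 * (2 / 3) ^ M"
  proof (induction M)
    case (Suc M)
    have "{- int (Suc M)..int (Suc M)} = insert (int (Suc M)) (insert (- int (Suc M)) {- int M..int M})"
      by auto
    then show ?case using Suc by (simp add: nat_add_distrib)
  qed simp
  also have "\<dots> \<le> 5" by simp
  finally show ?thesis .
qed

text \<open>A Chernoff bound with weight
  \<open>H (ip m (e 0) x) * ... * H (ip m (e (d - 1)) x)\<close>. The weight averages at most
  \<open>5 ^ d\<close>, and is at least \<open>exp (m / 8 - d / 4)\<close> when the squared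
  projection exceeds \<open>m / 2\<close>. Since \<open>5 <= exp (7 / 4)\<close>, the quotient is at
  most \<open>exp (2 * d - m / 8)\<close>.\<close>

lemma card_near_span_le:
  assumes e: "orthonormal m d e" and m: "m \<ge> 1"
  shows "real (card {x \<in> signs m. (\<Sum>l<d. (ip m (e l) x)\<^sup>2) > real m / 2})
           \<le> 2 ^ m * exp (2 * real d - real m / 8)"
proof -
  define H where "H u = (\<Sum>g\<in>{- int m..int m}. exp (- (real_of_int g)\<^sup>2 + real_of_int g * u))" for u
  have H_nonneg: "H u \<ge> 0" for u by (simp add: H_def sum_nonneg)
  \<comment> \<open>The linear term \<open>w\<close> is general so that the induction can absorb
    \<open>g * e i\<close> into it. Orthogonality adds exactly \<open>g^2\<close> to the squared
    norm, and \<open>exp (- g^2) * exp (g^2 / 2)\<close> leaves a lattice sum bounded by 5 per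
    direction.\<close>
  have mgf: "(\<Sum>x\<in>signs m. exp (ip m w x) * (\<Prod>l<i. H (ip m (e l) x))) \<le> 2 ^ m * 5 ^ i * exp (ip m w w / 2)"
    if "i \<le> d" "\<And>l. l < i \<Longrightarrow> ip m w (e l) = 0" for i w
    using that
  proof (induction i arbitrary: w)
    case 0
    then show ?case using sum_signs_exp_le by simp
  next
    case (Suc i)
    have ee: "ip m (e i) (e l) = of_bool (i = l)" if "l < Suc i" for l
      using e Suc.prems(1) that by (simp add: orthonormal_def)
    define w' where "w' = (\<lambda>g::int. \<lambda>b. w b + real_of_int g * e i b)"
    have w'w': "ip m (w' g) (w' g) = ip m w w + (real_of_int g)\<^sup>2" for g
      using Suc.prems(2)[of i] ee[of i] unfolding w'_def ip_bilinear
      by (simp add: ip_commute[of m "e i" w] power2_eq_square)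
    have "(\<Sum>x\<in>signs m. exp (ip m w x) * (\<Prod>l<Suc i. H (ip m (e l) x)))
        = (\<Sum>x\<in>signs m. \<Sum>g\<in>{- int m..int m}. exp (- (real_of_int g)\<^sup>2) * (exp (ip m (w' g) x) * (\<Prod>l<i. H (ip m (e l) x))))"
      unfolding w'_def ip_bilinear prod.lessThan_Suc H_def[of "ip m (e i) _"]
        exp_add sum_distrib_left
      by (simp add: mult_ac)
    also have "\<dots> = (\<Sum>g\<in>{- int m..int m}. exp (- (real_of_int g)\<^sup>2) * (\<Sum>x\<in>signs m. exp (ip m (w' g) x) * (\<Prod>l<i. H (ip m (e l) x))))"
      by (subst sum.swap) (simp add: sum_distrib_left)
    also have "\<dots> \<le> (\<Sum>g\<in>{- int m..int m}. exp (- (real_of_int g)\<^sup>2) * (2 ^ m * 5 ^ i * exp (ip m (w' g) (w' g) / 2)))"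
    proof (intro sum_mono mult_left_mono Suc.IH)
      fix g l assume "l < i"
      then show "ip m (w' g) (e l) = 0"
        using Suc.prems(2)[of l] ee[of l] unfolding w'_def ip_bilinear by simp
    qed (use Suc.prems in auto)
    also have "\<dots> = 2 ^ m * 5 ^ i * exp (ip m w w / 2) * (\<Sum>g\<in>{- int m..int m}. exp (- (real_of_int g)\<^sup>2 / 2))"
      unfolding w'w' sum_distrib_left
    proof (intro sum.cong refl)
      fix g :: int
      have "exp (- (real_of_int g)\<^sup>2) * exp ((ip m w w + (real_of_int g)\<^sup>2) / 2) = exp (ip m w w / 2) * exp (- (real_of_int g)\<^sup>2 / 2)"
        by (simp add: field_simps flip: exp_add)
      then show "exp (- (real_of_int g)\<^sup>2) * (2 ^ m * 5 ^ i * exp ((ip m w w + (real_of_int g)\<^sup>2) / 2)) =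
         2 ^ m * 5 ^ i * exp (ip m w w / 2) * exp (- (real_of_int g)\<^sup>2 / 2)"
        by (metis (no_types, lifting) mult.assoc mult.left_commute)
    qed
    also have "\<dots> \<le> 2 ^ m * 5 ^ i * exp (ip m w w / 2) * 5"
      by (intro mult_left_mono lattice_sum_le) auto
    finally show ?case by (simp add: mult_ac)
  qed
  let ?N = "{x \<in> signs m. (\<Sum>l<d. (ip m (e l) x)\<^sup>2) > real m / 2}"
  have "real (card ?N) * exp (real m / 8 - real d / 4) = (\<Sum>x\<in>?N. exp (real m / 8 - real d / 4))"
    by simp
  also have "\<dots> \<le> (\<Sum>x\<in>?N. \<Prod>l<d. H (ip m (e l) x))"
  proof (intro sum_mono)
    fix x assume x: "x \<in> ?N"
    \<comment> \<open>The range \<open>-m..m\<close> of the lattice sum must contain the integer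
      nearest to half the projection.\<close>
    have bd: "\<bar>ip m (e l) x\<bar> \<le> real m" if "l < d" for l
    proof -
      have "(ip m (e l) x)\<^sup>2 \<le> ip m (e l) (e l) * ip m x x"
        using Cauchy_Schwarz_ineq_sum[of "e l" x "{..<m}"] by (simp add: ip_def power2_eq_square)
      also have "\<dots> = real m" using e that x by (simp add: orthonormal_def ip_signs)
      also have "\<dots> \<le> (real m)\<^sup>2" using m by (simp add: power2_eq_square)
      finally show ?thesis using abs_le_square_iff[of "ip m (e l) x" "real m"] by simp
    qed
    have "exp (real m / 8 - real d / 4) \<le> exp (\<Sum>l<d. (ip m (e l) x)\<^sup>2 / 4 - 1 / 4)"
      using x by (simp add: sum_subtractf flip: sum_divide_distrib)
    also have "\<dots> = (\<Prod>l<d. exp ((ip m (e l) x)\<^sup>2 / 4 - 1 / 4))" by (simp add: exp_sum)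
    also have "\<dots> \<le> (\<Prod>l<d. H (ip m (e l) x))"
      unfolding H_def by (intro prod_mono conjI exp_sq_le_lattice_sum bd m) auto
    finally show "exp (real m / 8 - real d / 4) \<le> (\<Prod>l<d. H (ip m (e l) x))" .
  qed
  also have "\<dots> \<le> (\<Sum>x\<in>signs m. \<Prod>l<d. H (ip m (e l) x))"
    by (intro sum_mono2) (auto intro!: prod_nonneg H_nonneg)
  also have "\<dots> \<le> 2 ^ m * 5 ^ d"
    using mgf[of d "\<lambda>_. 0"] by (simp add: ip_def)
  also have "\<dots> \<le> 2 ^ m * exp (7 / 4) ^ d"
  proof (intro mult_left_mono power_mono)
    have "(5::real) \<le> (41 / 32) ^ 7" by (simp add: power_divide)
    also have "\<dots> \<le> exp (1 / 4) ^ 7"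
      using exp_lower_Taylor_quadratic[of "1 / 4 :: real"] by (intro power_mono) (auto simp: power2_eq_square)
    also have "\<dots> = exp (7 / 4)" by (simp flip: exp_of_nat_mult)
    finally show "(5::real) \<le> exp (7 / 4)" .
  qed auto
  also have "\<dots> = 2 ^ m * exp (2 * real d - real m / 8) * exp (real m / 8 - real d / 4)"
    by (simp flip: exp_of_nat_mult exp_add)
  finally show ?thesis by simp
qed

section \<open>Anticoncentration on large rectangles\<close>

text \<open>The centres are 16 apart, so at most one argument is closer to 0 than 8. The other terms
  are at most 1/256 before weighting, and the largest weight is 1/2.\<close>

lemma three_gauss_le:
  fixes s :: real
  shows "exp (- (s\<^sup>2 / 8)) / 2 + exp (- ((s + 16)\<^sup>2 / 8)) / 4 + exp (- ((s - 16)\<^sup>2 / 8)) / 4 \<le> 51 / 100"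
proof -
  have far: "exp (- (t\<^sup>2 / 8)) \<le> 1 / 256" if "\<bar>t\<bar> \<ge> 8" for t :: real
  proof -
    have "8\<^sup>2 \<le> t\<^sup>2" using that by (metis abs_le_square_iff abs_numeral)
    then have "exp (- (t\<^sup>2 / 8)) \<le> exp (- 8)" by simp
    also have "\<dots> \<le> 1 / 256"
    proof -
      have "(256::real) = 2 ^ 8" by simp
      also have "\<dots> \<le> exp 1 ^ 8" using exp_ge_add_one_self[of "1::real"] by (intro power_mono) auto
      also have "\<dots> = exp 8" by (simp flip: exp_of_nat_mult)
      finally show ?thesis by (simp add: exp_minus field_simps)
    qed
    finally show ?thesis .
  qed
  have le1: "exp (- (t\<^sup>2 / 8)) \<le> 1" for t :: real by simp
  consider "\<bar>s\<bar> \<le> 8" | "s > 8" | "s < - 8" by linarith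
  then show ?thesis
  proof cases
    case 1
    then show ?thesis using far[of "s + 16"] far[of "s - 16"] le1[of s] by linarith
  next
    case 2
    then show ?thesis using far[of "s + 16"] far[of s] le1[of "s - 16"] by linarith
  next
    case 3
    then show ?thesis using far[of s] far[of "s - 16"] le1[of "s + 16"] by linarith
  qed
qed

text \<open>
  The exponent is the squared distance from \<open>z\<close> to the span of \<open>e 0, \<dots>, e (d - 1)\<close>. Multiplying \<open>P\<close> by
  \<open>1/2 + cos (16 (ip m x y / m - v)) / 2\<close> averages three translates of \<open>z\<close> in direction \<open>x\<close> with weights
  \<open>1/2, 1/4, 1/4\<close>; if \<open>x\<close> is far from the span, only one of them can contribute, which is
  where the factor \<open>51/100\<close> per step comes from. The range of \<open>z\<close> shrinks to leave room for these translates.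
\<close>

definition fourier_decay :: "nat \<Rightarrow> nat \<Rightarrow> (nat \<Rightarrow> nat \<Rightarrow> real) \<Rightarrow> ((nat \<Rightarrow> nat \<Rightarrow> real) \<Rightarrow> real) \<Rightarrow> bool" where
  "fourier_decay m d e P \<longleftrightarrow> (\<forall>z. (\<forall>b<m. \<bar>z b\<bar> \<le> 1 - 16 * real d / real m) \<longrightarrow>
     norm (\<Sum>\<omega>\<in>sign_arrays m. of_real (P \<omega>) * cis (ip m z (row_sums m \<omega>)))
       \<le> real (card (sign_arrays m)) * (51 / 100) ^ d
           * exp (- (real m / 4 * (ip m z z - (\<Sum>l<d. (ip m (e l) z)\<^sup>2)))))"

lemma fourier_decay_extend:
  assumes e: "orthonormal m d e" and P: "fourier_decay m d e P" and x: "x \<in> signs m" and m: "m \<ge> 1"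
    and far: "(\<Sum>l<d. (ip m (e l) x)\<^sup>2) \<le> real m / 2"
  obtains e' where "orthonormal m (Suc d) e'"
    "fourier_decay m (Suc d) e' (\<lambda>\<omega>. P \<omega> * (1 / 2 + cos (16 * (ip m x (row_sums m \<omega>) / real m - v)) / 2))"
proof -
  define q where "q = ip m x x - (\<Sum>l<d. (ip m (e l) x)\<^sup>2)"
  have q: "q \<ge> real m / 2" "q > 0" using far m by (simp_all add: q_def ip_signs[OF x])
  obtain e' where e': "orthonormal m (Suc d) e'" "\<And>l. l < d \<Longrightarrow> e' l = e l"
    and e'd: "\<And>z. ip m (e' d) z = (ip m x z - (\<Sum>l<d. ip m (e l) x * ip m (e l) z)) / sqrt q"
    using orthonormal_extend[OF e q_def q(2)] by blast
  define K where "K \<omega> = 1 / 2 + cos (16 * (ip m x (row_sums m \<omega>) / real m - v)) / 2" for \<omega>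
  define C where "C = real (card (sign_arrays m)) * (51 / 100) ^ d"
  have "fourier_decay m (Suc d) e' (\<lambda>\<omega>. P \<omega> * K \<omega>)"
    unfolding fourier_decay_def
  proof (intro allI impI)
    fix z assume z: "\<forall>b<m. \<bar>z b\<bar> \<le> 1 - 16 * real (Suc d) / real m"
    define F where "F w = (\<Sum>\<omega>\<in>sign_arrays m. of_real (P \<omega>) * cis (ip m w (row_sums m \<omega>)))" for w
    define \<theta> where "\<theta> = 16 / real m"
    define z' where "z' t = (\<lambda>b. z b + t * x b)" for t
    \<comment> \<open>\<open>Q w\<close> and \<open>Q'\<close> are squared distances: from
      \<open>w\<close> to the old span and from \<open>z\<close> to the new one. As a function of
      \<open>t\<close>, \<open>Q (z' t)\<close> is quadratic with leading coefficient
      \<open>q\<close>, and its minimum \<open>Q'\<close> is attained at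
      \<open>t = - s\<close>.\<close>
    define B where "B = ip m x z - (\<Sum>l<d. ip m (e l) x * ip m (e l) z)"
    define s where "s = B / q"
    define Q where "Q w = ip m w w - (\<Sum>l<d. (ip m (e l) w)\<^sup>2)" for w
    define Q' where "Q' = ip m z z - (\<Sum>l<Suc d. (ip m (e' l) z)\<^sup>2)"
    have Q': "Q' = Q z - B\<^sup>2 / q"
      using e' q by (simp add: Q'_def Q_def e'd B_def power_divide)
    have Qz': "Q (z' t) = Q' + q * (t + s)\<^sup>2" for t
    proof -
      have "ip m (z' t) (z' t) = ip m z z + 2 * t * ip m x z + t\<^sup>2 * ip m x x"
        unfolding z'_def ip_bilinear by (simp add: ip_commute[of m z x] power2_eq_square algebra_simps)
      moreover have "(\<Sum>l<d. (ip m (e l) (z' t))\<^sup>2) = (\<Sum>l<d. (ip m (e l) z)\<^sup>2)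
          + 2 * t * (\<Sum>l<d. ip m (e l) x * ip m (e l) z) + t\<^sup>2 * (\<Sum>l<d. (ip m (e l) x)\<^sup>2)"
        unfolding z'_def ip_bilinear
        by (simp add: power2_eq_square algebra_simps sum.distrib sum_distrib_left)
      ultimately have "Q (z' t) = Q z + 2 * t * B + t\<^sup>2 * q"
        by (simp add: Q_def B_def q_def algebra_simps)
      also have "\<dots> = Q' + q * (t + s)\<^sup>2"
        using q by (simp add: Q' s_def power2_eq_square field_simps)
      finally show ?thesis .
    qed
    have F_le: "norm (F (z' t)) \<le> C * exp (- (real m / 4 * Q')) * exp (- ((real m * s + real m * t)\<^sup>2 / 8))"
      if t: "\<bar>t\<bar> \<le> \<theta>" for t
    proof -
      have "\<bar>z' t b\<bar> \<le> 1 - 16 * real d / real m" if "b < m" for b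
      proof -
        have "\<bar>z' t b\<bar> \<le> \<bar>z b\<bar> + \<bar>t\<bar>"
          using signs_apply[OF x that] by (auto simp: z'_def)
        also have "\<dots> \<le> (1 - 16 * real (Suc d) / real m) + 16 / real m"
          using z that t by (intro add_mono) (auto simp: \<theta>_def)
        also have "\<dots> = 1 - 16 * real d / real m" using m by (simp add: field_simps)
        finally show ?thesis .
      qed
      then have "norm (F (z' t)) \<le> C * exp (- (real m / 4 * Q (z' t)))"
        using P unfolding fourier_decay_def F_def C_def Q_def by blast
      also have "\<dots> \<le> C * exp (- (real m / 4 * Q') + - ((real m * s + real m * t)\<^sup>2 / 8))"
      proof -
        \<comment> \<open>Here \<open>q >= m / 2\<close>, the distance of \<open>x\<close> from the
          span, produces the variance used in \<open>three_gauss_le\<close>.\<close>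
        have "(real m * s + real m * t)\<^sup>2 / 8 = real m / 4 * (real m / 2 * (t + s)\<^sup>2)"
          by (simp add: power2_eq_square field_simps)
        also have "\<dots> \<le> real m / 4 * (q * (t + s)\<^sup>2)"
          using q by (intro mult_left_mono mult_right_mono) auto
        finally have "(real m * s + real m * t)\<^sup>2 / 8 \<le> real m / 4 * (q * (t + s)\<^sup>2)" .
        then show ?thesis by (intro mult_left_mono) (auto simp: Qz' C_def algebra_simps)
      qed
      finally show ?thesis by (simp only: exp_add mult.assoc)
    qed
    have m\<theta>: "real m * \<theta> = 16" using m by (simp add: \<theta>_def)
    have split: "of_real (P \<omega> * K \<omega>) * cis (ip m z Y)
        = (1 / 2) * (of_real (P \<omega>) * cis (ip m (z' 0) Y))
        + (cis (- 16 * v) / 4) * (of_real (P \<omega>) * cis (ip m (z' \<theta>) Y))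
        + (cis (16 * v) / 4) * (of_real (P \<omega>) * cis (ip m (z' (- \<theta>)) Y))"
      if "Y = row_sums m \<omega>" for \<omega> Y
    proof -
      \<comment> \<open>Each exponential in the kernel shifts the frequency \<open>z\<close> by a
        multiple \<open>\<theta>\<close> or \<open>- \<theta>\<close> of \<open>x\<close>; the
        phases depending on \<open>v\<close> have modulus 1 and vanish in the norm.\<close>
      define u where "u = 16 * (ip m x Y / real m - v)"
      have K: "of_real (K \<omega>) = 1 / 2 + (cis u + cis (- u)) / 4"
      proof -
        have "K \<omega> = 1 / 2 + cos u / 2" unfolding K_def u_def that ..
        then show ?thesis by (simp add: complex_eq_iff)
      qed
      have "cis (- 16 * v) * cis (ip m (z' \<theta>) Y) = cis u * cis (ip m z Y)"
        unfolding z'_def ip_bilinear cis_mult by (simp add: u_def \<theta>_def algebra_simps)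
      moreover have "cis (16 * v) * cis (ip m (z' (-\<theta>)) Y) = cis (- u) * cis (ip m z Y)"
        unfolding z'_def ip_bilinear cis_mult by (simp add: u_def \<theta>_def algebra_simps)
      moreover have "z' 0 = z" by (simp add: z'_def)
      ultimately show ?thesis unfolding of_real_mult K by (simp add: algebra_simps)
    qed
    have "(\<Sum>\<omega>\<in>sign_arrays m. of_real (P \<omega> * K \<omega>) * cis (ip m z (row_sums m \<omega>)))
        = (1 / 2) * F (z' 0) + (cis (- 16 * v) / 4) * F (z' \<theta>) + (cis (16 * v) / 4) * F (z' (- \<theta>))"
      unfolding F_def sum_distrib_left sum.distrib[symmetric]
      by (intro sum.cong refl split)
    then have "norm (\<Sum>\<omega>\<in>sign_arrays m. of_real (P \<omega> * K \<omega>) * cis (ip m z (row_sums m \<omega>)))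
        \<le> norm ((1 / 2) * F (z' 0)) + norm ((cis (- 16 * v) / 4) * F (z' \<theta>))
            + norm ((cis (16 * v) / 4) * F (z' (- \<theta>)))"
      by (simp only: order.trans[OF norm_triangle_ineq add_right_mono[OF norm_triangle_ineq]])
    also have "\<dots> = norm (F (z' 0)) / 2 + norm (F (z' \<theta>)) / 4 + norm (F (z' (- \<theta>))) / 4"
      by (simp add: norm_mult norm_divide)
    also have "\<dots> \<le> C * exp (- (real m / 4 * Q')) *
       (exp (- ((real m * s)\<^sup>2 / 8)) / 2 + exp (- ((real m * s + 16)\<^sup>2 / 8)) / 4 + exp (- ((real m * s - 16)\<^sup>2 / 8)) / 4)"
      using F_le[of 0] F_le[of \<theta>] F_le[of "- \<theta>"] m\<theta>
      by (simp add: algebra_simps) (simp add: \<theta>_def)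
    also have "\<dots> \<le> C * exp (- (real m / 4 * Q')) * (51 / 100)"
      by (intro mult_left_mono three_gauss_le) (simp add: C_def)
    finally show "norm (\<Sum>\<omega>\<in>sign_arrays m. of_real (P \<omega> * K \<omega>) * cis (ip m z (row_sums m \<omega>)))
       \<le> real (card (sign_arrays m)) * (51 / 100) ^ Suc d
           * exp (- (real m / 4 * (ip m z z - (\<Sum>l<Suc d. (ip m (e' l) z)\<^sup>2))))"
      by (simp add: C_def Q'_def mult_ac)
  qed
  then show thesis using that e'(1) unfolding K_def by blast
qed

text \<open>Dividing by \<open>m\<close> normalises the variance to 1; \<open>v\<close> is a
  rescaled protocol output. The tolerance keeps the kernel \<open>1/2 + cos (16 t) / 2\<close> above
  99/100, as \<open>16 / 80 = 1 / 5\<close>.\<close>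

definition close :: "nat \<Rightarrow> real \<Rightarrow> (nat \<Rightarrow> real) \<Rightarrow> (nat \<Rightarrow> nat \<Rightarrow> real) \<Rightarrow> bool" where
  "close m v x \<omega> \<longleftrightarrow> \<bar>ip m x (row_sums m \<omega>) / real m - v\<bar> \<le> 1 / 80"

section \<open>Double counting and the greedy choice of Alice's vectors\<close>

lemma sum_card_swap:
  assumes "finite A" "finite B"
  shows "(\<Sum>x\<in>A. card {y \<in> B. R x y}) = (\<Sum>y\<in>B. card {x \<in> A. R x y})"
proof -
  have "card {y \<in> B. R x y} = (\<Sum>y\<in>B. of_bool (R x y))" for x
    using assms by (simp add: of_bool_def sum.If_cases Int_def)
  moreover have "card {x \<in> A. R x y} = (\<Sum>x\<in>A. of_bool (R x y))" for y
    using assms by (simp add: of_bool_def sum.If_cases Int_def)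
  ultimately show ?thesis by (simp only:) (rule sum.swap)
qed

text \<open>Count the related pairs twice. If no good \<open>x\<close> kept 62 percent of
  \<open>U\<close>, then even with bad \<open>x\<close> keeping all of \<open>U\<close> the density
  would be at most 62.5 percent, below the assumed 63.\<close>

lemma exists_far_close:
  fixes S :: "'a set" and U :: "'b set"
  assumes fin: "finite S" "finite U" and U: "U \<noteq> {}" and S: "S \<noteq> {}"
    and deg: "\<And>y. y \<in> U \<Longrightarrow> real (card {x \<in> S. R x y}) \<ge> 63 / 100 * real (card S)"
    and bad: "real (card {x \<in> S. B x}) \<le> 5 / 1000 * real (card S)"
  obtains x where "x \<in> S" "\<not> B x" "real (card {y \<in> U. R x y}) \<ge> 62 / 100 * real (card U)"
proof -
  have pos: "real (card S) * real (card U) > 0" using fin U S by (simp add: card_gt_0_iff)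
  have "\<exists>x\<in>S. \<not> B x \<and> real (card {y \<in> U. R x y}) \<ge> 62 / 100 * real (card U)"
  proof (rule ccontr)
    assume "\<not> ?thesis"
    then have *: "real (card {y \<in> U. R x y}) \<le> 62 / 100 * real (card U) + of_bool (B x) * real (card U)"
      if "x \<in> S" for x
      using that card_mono[OF fin(2), of "{y \<in> U. R x y}"] by (cases "B x") force+
    have "63 / 100 * real (card S) * real (card U) = (\<Sum>y\<in>U. 63 / 100 * real (card S))" by simp
    also have "\<dots> \<le> (\<Sum>y\<in>U. real (card {x \<in> S. R x y}))" by (intro sum_mono deg)
    also have "\<dots> = (\<Sum>x\<in>S. real (card {y \<in> U. R x y}))"
      using sum_card_swap[OF fin, of R] by (simp flip: of_nat_sum)
    also have "\<dots> \<le> (\<Sum>x\<in>S. 62 / 100 * real (card U) + of_bool (B x) * real (card U))"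
      by (intro sum_mono *)
    also have "\<dots> = 62 / 100 * real (card S) * real (card U) + real (card {x \<in> S. B x}) * real (card U)"
      using fin(1) by (simp add: sum.distrib Int_def flip: sum_distrib_right)
    also have "\<dots> \<le> 62 / 100 * real (card S) * real (card U) + 5 / 1000 * real (card S) * real (card U)"
      by (intro add_left_mono mult_right_mono bad) auto
    finally show False using pos by (simp add: algebra_simps)
  qed
  then show thesis using that by blast
qed

text \<open>\<open>P\<close> is the product of the kernels of the chosen vectors and
  \<open>U\<close> the set of arrays close for all of them. \<open>P\<close> is large on
  \<open>U\<close> and nonnegative elsewhere, so its total bounds \<open>card U\<close>; decay at
  \<open>z = 0\<close> bounds that total from above. The degree condition survives because only
  \<open>U\<close> shrinks, never \<open>S\<close>.\<close>

lemma greedy_selection: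
  assumes S: "S \<subseteq> signs m" "S \<noteq> {}" and T: "T \<subseteq> sign_arrays m" "T \<noteq> {}" and m: "m \<ge> 1"
    and deg: "\<And>\<omega>. \<omega> \<in> T \<Longrightarrow> real (card {x \<in> S. close m v x \<omega>}) \<ge> 63 / 100 * real (card S)"
    and near: "\<And>d e. d < a \<Longrightarrow> orthonormal m d e \<Longrightarrow>
       real (card {x \<in> S. (\<Sum>l<d. (ip m (e l) x)\<^sup>2) > real m / 2}) \<le> 5 / 1000 * real (card S)"
    and "i \<le> a"
  shows "\<exists>e U P. orthonormal m i e \<and> fourier_decay m i e P \<and> U \<subseteq> T
     \<and> real (card U) \<ge> (62 / 100) ^ i * real (card T)
     \<and> (\<forall>\<omega>. P \<omega> \<ge> 0) \<and> (\<forall>\<omega>\<in>U. P \<omega> \<ge> (99 / 100) ^ i)"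
  using \<open>i \<le> a\<close>
proof (induction i)
  case 0
  have "orthonormal m 0 (\<lambda>_ _. 0)" by (simp add: orthonormal_def)
  moreover have "fourier_decay m 0 (\<lambda>_ _. 0) (\<lambda>_. 1)"
    using norm_sum_cis_le by (simp add: fourier_decay_def)
  ultimately show ?case by (intro exI[of _ "\<lambda>_ _. 0"] exI[of _ T] exI[of _ "\<lambda>_. 1"]) simp
next
  case (Suc i)
  then obtain e U P where e: "orthonormal m i e" and P: "fourier_decay m i e P" and U: "U \<subseteq> T"
    "real (card U) \<ge> (62 / 100) ^ i * real (card T)" and P0: "\<forall>\<omega>. P \<omega> \<ge> 0"
    and PU: "\<forall>\<omega>\<in>U. P \<omega> \<ge> (99 / 100) ^ i"
    by auto
  have fin: "finite S" "finite T" using S T finite_subset finite_signs finite_sign_arrays by blast+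
  have "(62 / 100) ^ i * real (card T) > 0" using fin T by (simp add: card_gt_0_iff)
  then have "U \<noteq> {}" using U by auto
  have finU: "finite U" using U fin finite_subset by blast
  obtain x where x: "x \<in> S" "\<not> (\<Sum>l<i. (ip m (e l) x)\<^sup>2) > real m / 2"
     and xU: "real (card {\<omega> \<in> U. close m v x \<omega>}) \<ge> 62 / 100 * real (card U)"
    by (rule exists_far_close[OF fin(1) finU \<open>U \<noteq> {}\<close> S(2), where R = "close m v"
          and B = "\<lambda>x. (\<Sum>l<i. (ip m (e l) x)\<^sup>2) > real m / 2"])
       (use deg U near[OF _ e] Suc.prems in auto)
  obtain e' where e': "orthonormal m (Suc i) e'"
    and P': "fourier_decay m (Suc i) e' (\<lambda>\<omega>. P \<omega> * (1 / 2 + cos (16 * (ip m x (row_sums m \<omega>) / real m - v)) / 2))"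
    using fourier_decay_extend[OF e P _ m, of x v] x S by force
  show ?case
  proof (intro exI[of _ e'] exI[of _ "{\<omega> \<in> U. close m v x \<omega>}"] exI conjI ballI allI)
    show "orthonormal m (Suc i) e'" by (rule e')
    show "fourier_decay m (Suc i) e' (\<lambda>\<omega>. P \<omega> * (1 / 2 + cos (16 * (ip m x (row_sums m \<omega>) / real m - v)) / 2))"
      by (rule P')
    show "{\<omega> \<in> U. close m v x \<omega>} \<subseteq> T" using U by blast
    show "real (card {\<omega> \<in> U. close m v x \<omega>}) \<ge> (62 / 100) ^ Suc i * real (card T)"
      using xU U(2) by simp
    show "P \<omega> * (1 / 2 + cos (16 * (ip m x (row_sums m \<omega>) / real m - v)) / 2) \<ge> 0" for \<omega>
    proof -
      have "1 / 2 + cos t / 2 \<ge> 0" for t :: real using cos_ge_minus_one[of t] by linarith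
      then show ?thesis using P0 by simp
    qed
    fix \<omega> assume \<omega>: "\<omega> \<in> {\<omega> \<in> U. close m v x \<omega>}"
    define t where "t = ip m x (row_sums m \<omega>) / real m - v"
    have "\<bar>t\<bar> \<le> 1 / 80" using \<omega> by (simp add: close_def t_def)
    then have "t\<^sup>2 \<le> (1 / 80)\<^sup>2" by (metis abs_le_square_iff abs_of_nonneg zero_le_divide_1_iff zero_le_numeral)
    then have "1 / 2 + cos (16 * t) / 2 \<ge> 99 / 100"
      using cos_ge_one_minus[of "16 * t"] by (simp add: power_mult_distrib power_divide)
    moreover have "P \<omega> \<ge> (99 / 100) ^ i" using PU \<omega> by simp
    ultimately have "P \<omega> * (1 / 2 + cos (16 * t) / 2) \<ge> (99 / 100) ^ i * (99 / 100)"
      using P0 by (intro mult_mono) auto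
    then show "P \<omega> * (1 / 2 + cos (16 * (ip m x (row_sums m \<omega>) / real m - v)) / 2) \<ge> (99 / 100) ^ Suc i"
      by (simp add: t_def mult_ac)
  qed
qed

text \<open>
  Bob's entries \<open>row_sums m \<omega> b / (6 sqrt m)\<close> have to lie in \<open>[-1, 1]\<close>; the arrays violating this are
  so rare that discarding them costs less than the gain in \<open>fourier_decay\<close>.
\<close>

definition bounded_arrays :: "nat \<Rightarrow> (nat \<Rightarrow> nat \<Rightarrow> real) set" where
  "bounded_arrays m = {..<m} \<rightarrow>\<^sub>E {x \<in> signs m. \<bar>\<Sum>l<m. x l\<bar> \<le> 6 * sqrt (real m)}"

lemma bounded_arrays_subset: "bounded_arrays m \<subseteq> sign_arrays m"
  unfolding bounded_arrays_def sign_arrays_def by (intro PiE_mono) auto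

lemma finite_bounded_arrays [simp]: "finite (bounded_arrays m)"
  using bounded_arrays_subset finite_sign_arrays finite_subset by blast

lemma abs_row_sums_le:
  "\<omega> \<in> bounded_arrays m \<Longrightarrow> b < m \<Longrightarrow> \<bar>row_sums m \<omega> b\<bar> \<le> 6 * sqrt (real m)"
  by (auto simp: bounded_arrays_def row_sums_def PiE_iff)

text \<open>Chernoff bound with the constant vector \<open>6 * c / sqrt m\<close> of squared norm
  36, giving \<open>exp (18 - 36) <= 2 ^ -18\<close>. The sign \<open>c\<close> selects the
  tail.\<close>

lemma card_large_sum_le:
  assumes m: "m \<ge> 1" and c: "c = 1 \<or> c = - 1"
  shows "real (card {x \<in> signs m. c * (\<Sum>l<m. x l) > 6 * sqrt (real m)}) \<le> 2 ^ m / 2 ^ 18"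
proof -
  let ?B = "{x \<in> signs m. c * (\<Sum>l<m. x l) > 6 * sqrt (real m)}"
  define w where "w = (\<lambda>_::nat. 6 * c / sqrt (real m))"
  have ipw: "ip m w x = 6 / sqrt (real m) * (c * (\<Sum>l<m. x l))" for x
    by (simp add: ip_def w_def sum_distrib_left sum_divide_distrib mult_ac)
  have ww: "ip m w w = 36"
    using m c by (auto simp: ip_def w_def field_simps)
  have "real (card ?B) * exp 36 = (\<Sum>x\<in>?B. exp 36)" by simp
  also have "\<dots> \<le> (\<Sum>x\<in>?B. exp (ip m w x))"
  proof (intro sum_mono)
    fix x assume "x \<in> ?B"
    then have "6 / sqrt (real m) * (6 * sqrt (real m)) \<le> ip m w x"
      unfolding ipw by (intro mult_left_mono) auto
    then show "exp 36 \<le> exp (ip m w x)" using m by simp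
  qed
  also have "\<dots> \<le> (\<Sum>x\<in>signs m. exp (ip m w x))" by (intro sum_mono2) auto
  also have "\<dots> \<le> 2 ^ m * exp (36 / 2)" using sum_signs_exp_le[of m w] ww by simp
  also have "\<dots> = 2 ^ m * exp (- 18) * exp (36::real)" by (simp flip: exp_add)
  finally have "real (card ?B) \<le> 2 ^ m * exp (- 18)" by simp
  also have "\<dots> \<le> 2 ^ m * (1 / 2 ^ 18)"
  proof (intro mult_left_mono)
    have "(2::real) ^ 18 \<le> exp 1 ^ 18" using exp_ge_add_one_self[of "1::real"] by (intro power_mono) auto
    also have "\<dots> = exp 18" by (simp flip: exp_of_nat_mult)
    finally show "exp (- 18 :: real) \<le> 1 / 2 ^ 18" by (simp add: exp_minus field_simps)
  qed simp
  finally show ?thesis by simp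
qed

text \<open>Both tails together have density at most \<open>2 ^ -17\<close> per row; the rows are
  independent, so the bound is raised to the power \<open>m\<close>.\<close>

lemma card_bounded_arrays_ge:
  assumes m: "m \<ge> 1"
  shows "real (card (bounded_arrays m)) \<ge> exp (- (real m / 65536)) * real (card (sign_arrays m))"
proof -
  let ?W = "{x \<in> signs m. \<bar>\<Sum>l<m. x l\<bar> \<le> 6 * sqrt (real m)}"
  let ?B = "\<lambda>c. {x \<in> signs m. c * (\<Sum>l<m. x l) > 6 * sqrt (real m)}"
  have *: "signs m = ?W \<union> (?B 1 \<union> ?B (- 1))" by auto
  have "card (signs m) \<le> card ?W + (card (?B 1) + card (?B (- 1)))"
    using card_Un_le[of ?W "?B 1 \<union> ?B (- 1)"] card_Un_le[of "?B 1" "?B (- 1)"]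
    unfolding *[symmetric] by linarith
  then have "real (card (signs m)) \<le> real (card ?W) + (real (card (?B 1)) + real (card (?B (- 1))))"
    by linarith
  also have "\<dots> \<le> real (card ?W) + (2 ^ m / 2 ^ 18 + 2 ^ m / 2 ^ 18)"
    by (intro add_left_mono add_mono card_large_sum_le m) auto
  finally have "real (card ?W) \<ge> (1 - 1 / 131072) * 2 ^ m" by (simp add: card_signs)
  moreover have "exp (- (1 / 65536) :: real) \<le> 1 - 1 / 131072"
    using exp_ge_add_one_self[of "1 / 65536 :: real"] by (simp add: exp_minus field_simps)
  ultimately have "real (card ?W) \<ge> exp (- (1 / 65536)) * 2 ^ m"
    by (meson mult_right_mono order.trans zero_le_numeral zero_le_power)
  then have "(exp (- (1 / 65536)) * 2 ^ m) ^ m \<le> real (card ?W) ^ m"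
    by (intro power_mono) auto
  then show ?thesis
    by (simp add: bounded_arrays_def card_funcsetE card_sign_arrays power_mult_distrib flip: exp_of_nat_mult)
qed

text \<open>Were the claim false, \<open>a\<close> greedy steps would keep mass
  \<open>(62/100 * 99/100) ^ a\<close>, up to the factor 2/100 and the density losses, against the
  Fourier bound \<open>(51/100) ^ a\<close>. The losses cost at most a factor 93/100 per step, and
  \<open>6138/10000 * 93/100\<close> still exceeds \<open>51/100 * 111/100\<close>.\<close>

lemma card_close_le:
  assumes S: "S \<subseteq> signs m" and T: "T \<subseteq> bounded_arrays m" and m: "m \<ge> 32000" and a: "a = m div 64"
    and dS: "real (card S) \<ge> exp (- (real a / 16)) * real (card (signs m))"
    and dT: "real (card T) \<ge> exp (- (real a / 16)) * real (card (bounded_arrays m))"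
  shows "real (card {(x, \<omega>) \<in> S \<times> T. close m v x \<omega>}) \<le> 65 / 100 * real (card S) * real (card T)"
proof (rule ccontr)
  assume neg: "\<not> ?thesis"
  have a500: "a \<ge> 500" and ma: "64 * a \<le> m" "m \<le> 128 * a" using a m by linarith+
  have m1: "m \<ge> 1" using m by simp
  have fin: "finite S" "finite T" using S T finite_subset finite_signs finite_bounded_arrays by blast+
  \<comment> \<open>By averaging, density above 65 percent leaves at least 2 percent of
    \<open>T\<close> with degree at least 63 percent.\<close>
  define T' where "T' = {\<omega> \<in> T. real (card {x \<in> S. close m v x \<omega>}) \<ge> 63 / 100 * real (card S)}"
  have finT': "finite T'" using fin by (simp add: T'_def)
  have Spos: "real (card S) > 0" using dS by (rule less_le_trans[rotated]) (simp add: card_signs)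
  have T': "real (card T') \<ge> 2 / 100 * real (card T)"
  proof -
    have "{(x, \<omega>) \<in> S \<times> T. close m v x \<omega>} = Sigma S (\<lambda>x. {\<omega> \<in> T. close m v x \<omega>})" by auto
    then have "card {(x, \<omega>) \<in> S \<times> T. close m v x \<omega>} = (\<Sum>\<omega>\<in>T. card {x \<in> S. close m v x \<omega>})"
      using fin by (simp add: sum_card_swap[of S T])
    then have "65 / 100 * real (card S) * real (card T) \<le> (\<Sum>\<omega>\<in>T. real (card {x \<in> S. close m v x \<omega>}))"
      using neg by simp
    also have "\<dots> \<le> (\<Sum>\<omega>\<in>T. 63 / 100 * real (card S) + of_bool (\<omega> \<in> T') * real (card S))"
    proof (intro sum_mono)
      fix \<omega> assume "\<omega> \<in> T"
      then show "real (card {x \<in> S. close m v x \<omega>}) \<le> 63 / 100 * real (card S) + of_bool (\<omega> \<in> T') * real (card S)"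
        using card_mono[OF fin(1), of "{x \<in> S. close m v x \<omega>}"] by (cases "\<omega> \<in> T'") (auto simp: T'_def)
    qed
    also have "\<dots> = 63 / 100 * real (card S) * real (card T) + real (card T') * real (card S)"
      using fin by (simp add: sum.distrib T'_def Int_def flip: sum_distrib_right)
    finally have "real (card S) * (2 / 100 * real (card T)) \<le> real (card S) * real (card T')"
      by (simp add: algebra_simps)
    then show ?thesis using Spos by (simp del: of_nat_0_less_iff)
  qed
  have "exp (- (real a / 16)) * (exp (- (real m / 65536)) * real (card (sign_arrays m)))
      \<le> exp (- (real a / 16)) * real (card (bounded_arrays m))"
    by (intro mult_left_mono card_bounded_arrays_ge m1) auto
  also have "\<dots> \<le> real (card T)" by (rule dT)
  finally have dT': "exp (- (real a / 16)) * (exp (- (real m / 65536)) * real (card (sign_arrays m))) \<le> real (card T)" .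
  have \<Omega>pos: "real (card (sign_arrays m)) > 0" by (simp add: card_sign_arrays)
  have "real (card T) > 0"
    using dT' by (rule less_le_trans[rotated]) (use \<Omega>pos in \<open>simp add: zero_less_mult_iff\<close>)
  then have "real (card T') > 0" using T' by linarith
  then have T'ne: "T' \<noteq> {}" by auto
  \<comment> \<open>As \<open>m / 8 >= 8 * a\<close> and \<open>d < a\<close>, the vectors near the
    span are so rare that they remain rare relative to \<open>S\<close>, whose density is at least
    \<open>exp (- a / 16)\<close>.\<close>
  have near: "real (card {x \<in> S. (\<Sum>l<d. (ip m (e l) x)\<^sup>2) > real m / 2}) \<le> 5 / 1000 * real (card S)"
    if "d < a" "orthonormal m d e" for d e
  proof -
    have "real (card {x \<in> S. (\<Sum>l<d. (ip m (e l) x)\<^sup>2) > real m / 2})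
        \<le> real (card {x \<in> signs m. (\<Sum>l<d. (ip m (e l) x)\<^sup>2) > real m / 2})"
      using S by (intro of_nat_mono card_mono) auto
    also have "\<dots> \<le> 2 ^ m * exp (2 * real d - real m / 8)"
      by (rule card_near_span_le[OF that(2) m1])
    also have "\<dots> \<le> 2 ^ m * exp (- real a + - (real a / 16))"
      using that(1) ma by simp
    also have "\<dots> = exp (- real a) * (exp (- (real a / 16)) * real (card (signs m)))"
      unfolding exp_add by (simp add: card_signs)
    also have "\<dots> \<le> exp (- real a) * real (card S)" by (intro mult_left_mono dS) auto
    also have "\<dots> \<le> 5 / 1000 * real (card S)"
    proof (intro mult_right_mono)
      have "501 \<le> exp (real a)" using exp_ge_add_one_self[of "real a"] a500 by linarith
      then show "exp (- real a) \<le> 5 / 1000" by (simp add: exp_minus field_simps)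
    qed simp
    finally show ?thesis .
  qed
  have T'sub: "T' \<subseteq> sign_arrays m" using T bounded_arrays_subset by (auto simp: T'_def)
  have "S \<noteq> {}" using Spos by auto
  have deg: "63 / 100 * real (card S) \<le> real (card {x \<in> S. close m v x \<omega>})" if "\<omega> \<in> T'" for \<omega>
    using that by (simp add: T'_def)
  obtain e U P where P: "fourier_decay m a e P" and U: "U \<subseteq> T'"
      "real (card U) \<ge> (62 / 100) ^ a * real (card T')"
    and P0: "\<forall>\<omega>. P \<omega> \<ge> 0" and PU: "\<forall>\<omega>\<in>U. P \<omega> \<ge> (99 / 100) ^ a"
    using greedy_selection[OF S \<open>S \<noteq> {}\<close> T'sub T'ne m1 deg near order_refl] by blast
  \<comment> \<open>After \<open>a\<close> steps the frequency 0 is still admissible, and there the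
    Fourier sum is just the sum of \<open>P\<close>.\<close>
  have "0 \<le> 1 - 16 * real a / real m" using ma m1 by (simp add: field_simps)
  then have "norm (\<Sum>\<omega>\<in>sign_arrays m. complex_of_real (P \<omega>)) \<le> real (card (sign_arrays m)) * (51 / 100) ^ a"
    using P[unfolded fourier_decay_def, rule_format, of "\<lambda>_. 0"] by (simp add: ip_def)
  then have upper: "(\<Sum>\<omega>\<in>sign_arrays m. P \<omega>) \<le> real (card (sign_arrays m)) * (51 / 100) ^ a"
    by (simp only: norm_of_real abs_le_iff flip: of_real_sum)
  have "(6138 / 10000) ^ a * (2 / 100 * (exp (- (real a / 16)) * (exp (- (real m / 65536)) * real (card (sign_arrays m)))))
      \<le> (6138 / 10000) ^ a * (2 / 100 * real (card T))"
    by (intro mult_left_mono dT') auto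
  also have "\<dots> \<le> (6138 / 10000) ^ a * real (card T')" using T' by (intro mult_left_mono) auto
  also have "\<dots> = (99 / 100) ^ a * ((62 / 100) ^ a * real (card T'))"
    by (simp flip: mult.assoc power_mult_distrib)
  also have "\<dots> \<le> (99 / 100) ^ a * real (card U)" by (intro mult_left_mono U) auto
  also have "\<dots> = (\<Sum>\<omega>\<in>U. (99 / 100) ^ a)" by simp
  also have "\<dots> \<le> (\<Sum>\<omega>\<in>U. P \<omega>)" using PU by (intro sum_mono) auto
  also have "\<dots> \<le> (\<Sum>\<omega>\<in>sign_arrays m. P \<omega>)"
    using P0 U T'sub by (intro sum_mono2) auto
  also note upper
  finally have "real (card (sign_arrays m)) * ((6138 / 10000) ^ a * (2 / 100 * (exp (- (real a / 16)) * exp (- (real m / 65536)))))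
      \<le> real (card (sign_arrays m)) * (51 / 100) ^ a"
    by (simp add: mult_ac)
  then have "(6138 / 10000) ^ a * (2 / 100 * exp (- (real a / 16) + - (real m / 65536))) \<le> (51 / 100) ^ a"
    unfolding exp_add using \<Omega>pos by (simp del: of_nat_0_less_iff)
  moreover have "exp (- (real a / 16) + - (real m / 65536)) \<ge> (93 / 100) ^ a"
  \<comment> \<open>With \<open>m <= 128 * a\<close> the exponent is at least
    \<open>- 7/100 * a\<close>, and \<open>1 - 7/100 = 93/100\<close>.\<close>
  proof -
    have "(93 / 100 :: real) ^ a \<le> exp (- (7 / 100)) ^ a"
      using exp_ge_add_one_self[of "- (7 / 100) :: real"] by (intro power_mono) auto
    also have "\<dots> = exp (- (7 / 100) * real a)" by (simp flip: exp_of_nat_mult add: mult.commute)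
    also have "\<dots> \<le> exp (- (real a / 16) + - (real m / 65536))" using ma by simp
    finally show ?thesis .
  qed
  ultimately have "(6138 / 10000) ^ a * (2 / 100 * (93 / 100) ^ a) \<le> (51 / 100 :: real) ^ a"
    by (meson mult_left_mono order.trans zero_le_power divide_nonneg_nonneg zero_le_numeral)
  moreover have "(51 / 100 :: real) ^ a * (1 + real a * (11 / 100)) \<le> (6138 / 10000) ^ a * (93 / 100) ^ a"
  proof -
    have "(51 / 100 :: real) ^ a * (1 + real a * (11 / 100)) \<le> (51 / 100) ^ a * (1 + 11 / 100) ^ a"
      by (intro mult_left_mono Bernoulli_inequality) auto
    also have "\<dots> = (51 / 100 * (111 / 100)) ^ a" by (simp flip: power_mult_distrib)
    also have "\<dots> \<le> (6138 / 10000 * (93 / 100)) ^ a" by (intro power_mono) auto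
    finally show ?thesis by (simp only: power_mult_distrib)
  qed
  moreover have scale: "A * t * (2 / 100) \<le> A" if "X * (2 / 100 * Y) \<le> A" "A * t \<le> X * Y" for A t X Y :: real
    using mult_right_mono[OF that(2), of "2 / 100"] that(1) by (simp add: mult_ac)
  ultimately have "(51 / 100 :: real) ^ a * (1 + real a * (11 / 100)) * (2 / 100) \<le> (51 / 100) ^ a"
    by (intro scale)
  then have "(1 + real a * (11 / 100)) * (2 / 100) \<le> 1" by (simp add: mult.assoc)
  then show False using a500 by simp
qed

section \<open>From rectangles to protocols\<close>

text \<open>Each node splits the rectangle along one side. The \<open>\<alpha>\<close> term is
  additive under the split, while \<open>\<beta>\<close> is paid once per leaf, at most
  \<open>2 ^ depth \<pi>\<close> times.\<close>

lemma card_run_le: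
  assumes fin: "finite A" "finite B"
    and leaf: "\<And>S T r. S \<subseteq> A \<Longrightarrow> T \<subseteq> B \<Longrightarrow>
        real (card {(x, y) \<in> S \<times> T. G r x y}) \<le> \<alpha> * real (card S) * real (card T) + \<beta>"
    and \<beta>: "\<beta> \<ge> 0" and "S \<subseteq> A" "T \<subseteq> B"
  shows "real (card {(x, y) \<in> S \<times> T. G (run \<pi> (f x) (g y)) x y})
           \<le> \<alpha> * real (card S) * real (card T) + 2 ^ depth \<pi> * \<beta>"
  using assms(5,6)
proof (induction \<pi> arbitrary: S T)
  case (Output r)
  then show ?case using leaf by simp
next
  case (Alice p s t)
  let ?X = "\<lambda>\<pi> S. {(x, y) \<in> S \<times> T. G (run \<pi> (f x) (g y)) x y}"
  define S1 S2 where "S1 = {x \<in> S. p (f x)}" and "S2 = {x \<in> S. \<not> p (f x)}"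
  have finS: "finite S" "finite T" using Alice.prems fin finite_subset by blast+
  have "card S = card (S1 \<union> S2)" by (rule arg_cong[of _ _ card]) (auto simp: S1_def S2_def)
  also have "\<dots> = card S1 + card S2"
    using finS by (intro card_Un_disjoint) (auto simp: S1_def S2_def)
  finally have S: "real (card S) = real (card S1) + real (card S2)" by simp
  have "?X (Alice p s t) S = ?X s S1 \<union> ?X t S2" by (auto simp: S1_def S2_def)
  then have "real (card (?X (Alice p s t) S)) \<le> real (card (?X s S1)) + real (card (?X t S2))"
    by (metis (no_types, lifting) card_Un_le of_nat_add of_nat_mono)
  also have "\<dots> \<le> (\<alpha> * real (card S1) * real (card T) + 2 ^ depth s * \<beta>)
      + (\<alpha> * real (card S2) * real (card T) + 2 ^ depth t * \<beta>)"
    using Alice.prems by (intro add_mono Alice.IH) (auto simp: S1_def S2_def)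
  also have "\<dots> \<le> \<alpha> * real (card S) * real (card T) + 2 ^ depth (Alice p s t) * \<beta>"
  proof -
    have "2 ^ depth s * \<beta> \<le> 2 ^ max (depth s) (depth t) * \<beta>" "2 ^ depth t * \<beta> \<le> 2 ^ max (depth s) (depth t) * \<beta>"
      using \<beta> by (auto intro!: mult_right_mono power_increasing)
    then show ?thesis by (simp add: S algebra_simps)
  qed
  finally show ?case .
next
  case (Bob p s t)
  let ?X = "\<lambda>\<pi> T. {(x, y) \<in> S \<times> T. G (run \<pi> (f x) (g y)) x y}"
  define T1 T2 where "T1 = {y \<in> T. p (g y)}" and "T2 = {y \<in> T. \<not> p (g y)}"
  have finS: "finite S" "finite T" using Bob.prems fin finite_subset by blast+
  have "card T = card (T1 \<union> T2)" by (rule arg_cong[of _ _ card]) (auto simp: T1_def T2_def)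
  also have "\<dots> = card T1 + card T2"
    using finS by (intro card_Un_disjoint) (auto simp: T1_def T2_def)
  finally have T: "real (card T) = real (card T1) + real (card T2)" by simp
  have "?X (Bob p s t) T = ?X s T1 \<union> ?X t T2" by (auto simp: T1_def T2_def)
  then have "real (card (?X (Bob p s t) T)) \<le> real (card (?X s T1)) + real (card (?X t T2))"
    by (metis (no_types, lifting) card_Un_le of_nat_add of_nat_mono)
  also have "\<dots> \<le> (\<alpha> * real (card S) * real (card T1) + 2 ^ depth s * \<beta>)
      + (\<alpha> * real (card S) * real (card T2) + 2 ^ depth t * \<beta>)"
    using Bob.prems by (intro add_mono Bob.IH) (auto simp: T1_def T2_def)
  also have "\<dots> \<le> \<alpha> * real (card S) * real (card T) + 2 ^ depth (Bob p s t) * \<beta>"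
  proof -
    have "2 ^ depth s * \<beta> \<le> 2 ^ max (depth s) (depth t) * \<beta>" "2 ^ depth t * \<beta> \<le> 2 ^ max (depth s) (depth t) * \<beta>"
      using \<beta> by (auto intro!: mult_right_mono power_increasing)
    then show ?thesis by (simp add: T algebra_simps)
  qed
  finally show ?case .
qed

text \<open>A leaf rectangle with a side of density below \<open>\<eta>\<close> contains at most
  \<open>\<eta> * N\<close> pairs; on the others anticoncentration caps success at 65/100. The gap
  \<open>2/3 - 65/100 = 1/60\<close> has to be covered by
  \<open>2 ^ depth \<pi> * \<eta>\<close>.\<close>

lemma depth_ge_of_close:
  fixes f :: "(nat \<Rightarrow> real) \<Rightarrow> 'p" and g :: "(nat \<Rightarrow> nat \<Rightarrow> real) \<Rightarrow> 'q"
  assumes m: "m \<ge> 32000"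
    and succ: "real (card {(x, \<omega>) \<in> signs m \<times> bounded_arrays m. close m (h (run \<pi> (f x) (g \<omega>))) x \<omega>})
           \<ge> 2 / 3 * real (card (signs m)) * real (card (bounded_arrays m))"
  shows "real (depth \<pi>) \<ge> real m / 4096"
proof -
  define a where "a = m div 64"
  have a500: "a \<ge> 500" and ma: "64 * a \<le> m" "m \<le> 64 * a + 63" using a_def m by linarith+
  define N where "N = real (card (signs m)) * real (card (bounded_arrays m))"
  define \<eta> where "\<eta> = exp (- (real a / 16))"
  have "real (card (bounded_arrays m)) > 0"
    using card_bounded_arrays_ge[of m] m
    by (intro less_le_trans[OF _ card_bounded_arrays_ge[of m]]) (auto simp: card_sign_arrays)
  then have N: "N > 0" by (simp add: N_def card_signs)
  have leaf: "real (card {(x, \<omega>) \<in> S \<times> T. close m (h r) x \<omega>}) \<le> 65 / 100 * real (card S) * real (card T) + \<eta> * N"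
    if S: "S \<subseteq> signs m" and T: "T \<subseteq> bounded_arrays m" for S T r
  proof (cases "real (card S) \<ge> \<eta> * real (card (signs m)) \<and> real (card T) \<ge> \<eta> * real (card (bounded_arrays m))")
    case True
    then have "real (card {(x, \<omega>) \<in> S \<times> T. close m (h r) x \<omega>}) \<le> 65 / 100 * real (card S) * real (card T)"
      using card_close_le[OF S T m a_def] by (simp add: \<eta>_def)
    also have "\<dots> \<le> \<dots> + \<eta> * N" using N by (simp add: \<eta>_def)
    finally show ?thesis .
  next
    case False
    have fin: "finite S" "finite T" using S T finite_subset finite_signs finite_bounded_arrays by blast+
    have cS: "real (card S) \<le> real (card (signs m))" using S by (intro of_nat_mono card_mono) auto
    have cT: "real (card T) \<le> real (card (bounded_arrays m))" using T by (intro of_nat_mono card_mono) auto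
    have "card {(x, \<omega>) \<in> S \<times> T. close m (h r) x \<omega>} \<le> card (S \<times> T)"
      using fin by (intro card_mono) auto
    then have "real (card {(x, \<omega>) \<in> S \<times> T. close m (h r) x \<omega>}) \<le> real (card S) * real (card T)"
      unfolding card_cartesian_product of_nat_mult[symmetric] of_nat_le_iff .
    also have "\<dots> \<le> \<eta> * N"
    proof (cases "real (card S) \<ge> \<eta> * real (card (signs m))")
      case False
      then have "real (card S) * real (card T) \<le> (\<eta> * real (card (signs m))) * real (card (bounded_arrays m))"
        using cT by (intro mult_mono) (auto simp: \<eta>_def)
      then show ?thesis by (simp add: N_def)
    next
      case True
      with False have "real (card T) \<le> \<eta> * real (card (bounded_arrays m))" by simp
      then have "real (card S) * real (card T) \<le> real (card (signs m)) * (\<eta> * real (card (bounded_arrays m)))"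
        using cS by (intro mult_mono) auto
      then show ?thesis by (simp add: N_def mult_ac)
    qed
    finally show ?thesis by (simp add: add_increasing)
  qed
  have "2 / 3 * N \<le> real (card {(x, \<omega>) \<in> signs m \<times> bounded_arrays m. close m (h (run \<pi> (f x) (g \<omega>))) x \<omega>})"
    using succ by (simp add: N_def)
  also have "\<dots> \<le> 65 / 100 * real (card (signs m)) * real (card (bounded_arrays m)) + 2 ^ depth \<pi> * (\<eta> * N)"
    by (rule card_run_le[where G = "\<lambda>r. close m (h r)", OF _ _ leaf]) (use N in \<open>auto simp: \<eta>_def\<close>)
  also have "\<dots> = (65 / 100 + 2 ^ depth \<pi> * \<eta>) * N" by (simp add: N_def algebra_simps)
  finally have "2 / 3 \<le> 65 / 100 + 2 ^ depth \<pi> * \<eta>" using N by simp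
  then have "1 \<le> 60 * 2 ^ depth \<pi> * \<eta>" by simp
  also have "\<dots> \<le> exp 6 * exp (real (depth \<pi>)) * exp (- (real a / 16))"
  proof -
    have two: "(2::real) ^ n \<le> exp (real n)" for n
    proof -
      have "(2::real) ^ n \<le> exp 1 ^ n" using exp_ge_add_one_self[of "1::real"] by (intro power_mono) auto
      then show ?thesis by (simp flip: exp_of_nat_mult)
    qed
    have "60 \<le> exp (6::real)" using two[of 6] by simp
    then show ?thesis using two[of "depth \<pi>"] by (simp add: \<eta>_def mult_mono)
  qed
  also have "\<dots> = exp (6 + real (depth \<pi>) - real a / 16)" by (simp flip: exp_add)
  finally have "real a / 16 \<le> 6 + real (depth \<pi>)" by simp
  then show ?thesis using a500 ma by linarith
qed

section \<open>Embedding into Double-Indexing\<close>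

text \<open>
  Vectors of length \<open>r * r\<close> are read as \<open>r \<times> r\<close> matrices. Alice's index is a uniformly random row and her
  string is that row; Bob's index is a uniformly random column \<open>j\<close> and his string consists of independent
  signs whose expectations are the entries of that column, so real entries in \<open>[-1, 1]\<close> are allowed.
\<close>

definition alice_pmf :: "nat \<Rightarrow> nat \<Rightarrow> (nat \<Rightarrow> real) \<Rightarrow> (nat \<times> (nat \<Rightarrow> real)) pmf" where
  "alice_pmf k r x = map_pmf (\<lambda>i. (i, \<lambda>j\<in>{1..2 ^ k}. if j \<le> r then x ((i - 1) * r + (j - 1)) else 1))
     (pmf_of_set {1..r})"

text \<open>Bias \<open>(1 + u) / 2\<close> gives a sign of mean \<open>u\<close>; positions beyond
  \<open>r\<close> are padded with 1. The default \<open>undefined\<close> makes the samples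
  extensional, as \<open>DI_inputs\<close> demands. Positions start at 1 and vector coordinates at
  0, hence the subtractions.\<close>

definition bob_column :: "nat \<Rightarrow> nat \<Rightarrow> (nat \<Rightarrow> real) \<Rightarrow> nat \<Rightarrow> (nat \<Rightarrow> real) pmf" where
  "bob_column k r u j = Pi_pmf {1..2 ^ k} undefined (\<lambda>i. map_pmf (\<lambda>c. if c then 1 else - 1)
     (bernoulli_pmf (if i \<le> r then (1 + u ((i - 1) * r + (j - 1))) / 2 else 1)))"

definition bob_pmf :: "nat \<Rightarrow> nat \<Rightarrow> (nat \<Rightarrow> real) \<Rightarrow> (nat \<times> (nat \<Rightarrow> real)) pmf" where
  "bob_pmf k r u = bind_pmf (pmf_of_set {1..r}) (\<lambda>j. map_pmf (Pair j) (bob_column k r u j))"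

lemma set_bob_column: "set_pmf (bob_column k r u j) \<subseteq> {1..2 ^ k} \<rightarrow>\<^sub>E {- 1, 1}"
proof -
  define p :: "nat \<Rightarrow> real pmf" where "p = (\<lambda>i. map_pmf (\<lambda>c. if c then 1 else - 1)
     (bernoulli_pmf (if i \<le> r then (1 + u ((i - 1) * r + (j - 1))) / 2 else 1)))"
  have p: "set_pmf (p i) \<subseteq> {- 1, 1}" for i unfolding p_def set_map_pmf by auto
  have "set_pmf (bob_column k r u j) = PiE_dflt {1..2 ^ k} undefined (set_pmf \<circ> p)"
    unfolding bob_column_def p_def by (rule set_Pi_pmf) simp
  also have "\<dots> \<subseteq> PiE_dflt {1..2 ^ k} undefined (\<lambda>_. {- 1, 1})"
    using p by (force simp: PiE_dflt_def)
  also have "\<dots> = {1..2 ^ k} \<rightarrow>\<^sub>E {- 1, 1}"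
    unfolding PiE_dflt_def PiE_def Pi_def extensional_def by blast
  finally show ?thesis .
qed

lemma set_alice_pmf:
  assumes r: "1 \<le> r" "r \<le> 2 ^ k" and x: "x \<in> signs (r * r)"
  shows "set_pmf (alice_pmf k r x) \<subseteq> DI_inputs k"
proof -
  have *: "x ((i - 1) * r + (j - 1)) \<in> {- 1, 1}" if "i \<in> {1..r}" "j \<in> {1..r}" for i j
  proof -
    have "(i - 1) * r + (j - 1) < (i - 1) * r + r" using that by auto
    also have "\<dots> = i * r" using that by (cases i) auto
    also have "\<dots> \<le> r * r" using that by auto
    finally show ?thesis using signs_apply[OF x] by auto
  qed
  have "(\<lambda>j\<in>{1..2 ^ k}. if j \<le> r then x ((i - 1) * r + (j - 1)) else 1) \<in> {1..2 ^ k} \<rightarrow>\<^sub>E {- 1, 1}"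
    if i: "i \<in> {1..r}" for i
    unfolding restrict_PiE_iff
  proof
    fix j :: nat assume j: "j \<in> {1..2 ^ k}"
    show "(if j \<le> r then x ((i - 1) * r + (j - 1)) else 1) \<in> {- 1, 1}"
    proof (cases "j \<le> r")
      case True
      with j have "j \<in> {1..r}" by simp
      from *[OF i this] show ?thesis unfolding if_P[OF True] .
    qed simp
  qed
  then have "(\<lambda>i. (i, \<lambda>j\<in>{1..2 ^ k}. if j \<le> r then x ((i - 1) * r + (j - 1)) else 1)) ` {1..r} \<subseteq> DI_inputs k"
    using r unfolding DI_inputs_def by (intro image_subsetI SigmaI) auto
  then show ?thesis using r unfolding alice_pmf_def by simp
qed

lemma set_bob_pmf:
  assumes "1 \<le> r" "r \<le> 2 ^ k"
  shows "set_pmf (bob_pmf k r u) \<subseteq> DI_inputs k"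
  using assms set_bob_column[of k r u] by (auto simp: bob_pmf_def DI_inputs_def)

lemma expectation_bob_column:
  assumes r: "r \<le> 2 ^ k" and i: "i \<in> {1..r}" and u: "\<bar>u ((i - 1) * r + (j - 1))\<bar> \<le> 1"
  shows "measure_pmf.expectation (bob_column k r u j) (\<lambda>y. y i) = u ((i - 1) * r + (j - 1))"
proof -
  have "measure_pmf.expectation (bob_column k r u j) (\<lambda>y. y i)
      = measure_pmf.expectation (map_pmf (\<lambda>y. y i) (bob_column k r u j)) (\<lambda>t. t)"
    by simp
  also have "map_pmf (\<lambda>y. y i) (bob_column k r u j)
      = map_pmf (\<lambda>c. if c then 1 else - 1) (bernoulli_pmf ((1 + u ((i - 1) * r + (j - 1))) / 2))"
    unfolding bob_column_def using i r by (subst Pi_pmf_component) auto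
  also have "measure_pmf.expectation \<dots> (\<lambda>t. t) = u ((i - 1) * r + (j - 1))"
    using u by (simp add: field_simps abs_le_iff)
  finally show ?thesis .
qed

lemma sum_square_index:
  fixes F :: "nat \<Rightarrow> real"
  shows "(\<Sum>i=1..r. \<Sum>j=1..r. F ((i - 1) * r + (j - 1))) = (\<Sum>b<r * r. F b)"
proof -
  have "(\<Sum>i=1..r. \<Sum>j=1..r. F ((i - 1) * r + (j - 1))) = (\<Sum>i<r. \<Sum>j<r. F (i * r + j))"
    by (simp add: sum.atLeast1_atMost_eq)
  also have "\<dots> = (\<Sum>i<r. sum F {i * r..<i * r + r})"
    by (simp add: sum.atLeastLessThan_shift_0[of _ "_ * r" "_ * r + r"] lessThan_atLeast0)
  also have "\<dots> = (\<Sum>b<r * r. F b)" by (rule sum.nat_group)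
  finally show ?thesis .
qed

text \<open>For row \<open>i\<close> and column \<open>j\<close>, Alice supplies the matrix entry of
  \<open>x\<close> and Bob an independent sign whose mean is the entry of \<open>u\<close>.
  Averaging over all \<open>r * r\<close> positions gives the normalised inner product.\<close>

lemma expectation_DI:
  assumes r: "1 \<le> r" "r \<le> 2 ^ k" and u: "\<And>b. b < r * r \<Longrightarrow> \<bar>u b\<bar> \<le> 1"
  shows "measure_pmf.expectation (pair_pmf (alice_pmf k r x) (bob_pmf k r u)) (\<lambda>(a, b). DI a b)
       = ip (r * r) x u / real (r * r)"
proof -
  define \<phi> where "\<phi> i = (i, \<lambda>j\<in>{1..2 ^ k}. if j \<le> r then x ((i - 1) * r + (j - 1)) else 1)" for i
  have fin: "finite (set_pmf (bob_column k r u j))" for j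
    by (rule finite_subset[OF set_bob_column]) (simp add: finite_PiE)
  have pair: "pair_pmf (alice_pmf k r x) (bob_pmf k r u) = bind_pmf (pmf_of_set {1..r}) (\<lambda>i.
      bind_pmf (pmf_of_set {1..r}) (\<lambda>j. map_pmf (\<lambda>y. (\<phi> i, (j, y))) (bob_column k r u j)))"
    by (simp add: alice_pmf_def bob_pmf_def pair_pmf_def map_pmf_def bind_assoc_pmf bind_return_pmf \<phi>_def)
  have inner: "measure_pmf.expectation (map_pmf (\<lambda>y. (\<phi> i, (j, y))) (bob_column k r u j)) (\<lambda>(a, b). DI a b)
      = x ((i - 1) * r + (j - 1)) * u ((i - 1) * r + (j - 1))" if "i \<in> {1..r}" "j \<in> {1..r}" for i j
  proof -
    have "(i - 1) * r + (j - 1) < (i - 1) * r + r" using that by auto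
    also have "\<dots> = i * r" using that by (cases i) auto
    also have "\<dots> \<le> r * r" using that by auto
    finally have "\<bar>u ((i - 1) * r + (j - 1))\<bar> \<le> 1" by (rule u)
    then show ?thesis
      using that r expectation_bob_column[OF r(2) that(1), of u j] by (simp add: DI_def \<phi>_def)
  qed
  have "measure_pmf.expectation (pair_pmf (alice_pmf k r x) (bob_pmf k r u)) (\<lambda>(a, b). DI a b)
      = (\<Sum>i=1..r. (\<Sum>j=1..r. measure_pmf.expectation (map_pmf (\<lambda>y. (\<phi> i, (j, y))) (bob_column k r u j)) (\<lambda>(a, b). DI a b) / real r) / real r)"
    unfolding pair using r fin
    by (simp add: pmf_expectation_bind_pmf_of_set divide_inverse mult.commute)
  also have "\<dots> = (\<Sum>i=1..r. (\<Sum>j=1..r. x ((i - 1) * r + (j - 1)) * u ((i - 1) * r + (j - 1)) / real r) / real r)"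
    by (intro sum.cong refl arg_cong2[where f = "(/)"] inner)
  also have "\<dots> = (\<Sum>i=1..r. \<Sum>j=1..r. x ((i - 1) * r + (j - 1)) * u ((i - 1) * r + (j - 1))) / real (r * r)"
    by (simp add: sum_divide_distrib)
  also have "\<dots> = ip (r * r) x u / real (r * r)"
    unfolding ip_def by (subst sum_square_index[where F = "\<lambda>b. x b * u b"]) simp
  finally show ?thesis .
qed

text \<open>The averaging half of Yao's principle: it fixes the shared randomness. Measurability of
  the events follows from \<open>c > 0\<close>, since a non-measurable set has
  \<open>measure\<close> 0.\<close>

lemma (in prob_space) exists_frequent_point:
  fixes E :: "'i \<Rightarrow> 'a \<Rightarrow> bool"
  assumes I: "finite I" "I \<noteq> {}" and E: "\<And>i. i \<in> I \<Longrightarrow> measure M {\<pi> \<in> space M. E i \<pi>} \<ge> c" and c: "c > 0"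
  obtains \<pi> where "\<pi> \<in> space M" "real (card {i \<in> I. E i \<pi>}) \<ge> c * real (card I)"
proof -
  have meas: "{\<pi> \<in> space M. E i \<pi>} \<in> sets M" if "i \<in> I" for i
    using E[OF that] c measure_notin_sets[of "{\<pi> \<in> space M. E i \<pi>}" M] by fastforce
  let ?X = "\<lambda>\<pi>. \<Sum>i\<in>I. indicator {\<pi> \<in> space M. E i \<pi>} \<pi> :: real"
  have int: "integrable M ?X"
    using meas by (intro Bochner_Integration.integrable_sum integrable_real_indicator) (auto simp: emeasure_eq_measure)
  have X: "?X \<pi> = real (card {i \<in> I. E i \<pi>})" if "\<pi> \<in> space M" for \<pi>
    using I that by (simp add: indicator_def sum.If_cases Int_def)
  have "c * real (card I) = (\<Sum>i\<in>I. c)" by simp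
  also have "\<dots> \<le> (\<Sum>i\<in>I. measure M {\<pi> \<in> space M. E i \<pi>})" by (intro sum_mono E)
  also have "\<dots> = expectation ?X"
    using meas by (subst Bochner_Integration.integral_sum) (auto simp: emeasure_eq_measure)
  finally have le: "c * real (card I) \<le> expectation ?X" .
  have "\<exists>\<pi>\<in>space M. real (card {i \<in> I. E i \<pi>}) \<ge> c * real (card I)"
  proof (rule ccontr)
    assume "\<not> ?thesis"
    then have "expectation ?X < c * real (card I)"
      using X by (intro expectation_less int AE_I2) (auto simp: not_le)
    with le show False by simp
  qed
  then show thesis using that by blast
qed

text \<open>Covers \<open>\<epsilon>\<close> too large for the asymptotic bound. With
  \<open>r = 1\<close> the expectation can be 1 or -1, and for \<open>\<epsilon> < 1\<close> no
  constant output serves both; succeeding on two thirds of two inputs means succeeding on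
  both.\<close>

lemma estimates_DI_depth_pos:
  assumes M: "estimates \<epsilon> (DI_inputs k) (DI_inputs k) DI M" and \<epsilon>: "\<epsilon> < 1"
  obtains \<pi> where "\<pi> \<in> space M" "depth \<pi> \<ge> 1"
proof -
  interpret prob_space M using M by (simp add: estimates_def)
  define p where "p = alice_pmf k 1 (\<lambda>i\<in>{..<1}. 1)"
  define q where "q s = bob_pmf k 1 (\<lambda>_. s)" for s
  have p: "set_pmf p \<subseteq> DI_inputs k"
    unfolding p_def by (rule set_alice_pmf) (auto simp: signs_def)
  have q: "set_pmf (q s) \<subseteq> DI_inputs k" for s
    unfolding q_def by (rule set_bob_pmf) auto
  have E: "measure_pmf.expectation (pair_pmf p (q s)) (\<lambda>(a, b). DI a b) = s" if "s \<in> {- 1, 1}" for s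
    using expectation_DI[of 1 k "\<lambda>_. s" "\<lambda>i\<in>{..<1}. 1"] that by (auto simp: p_def q_def ip_def)
  have succ: "2 / 3 \<le> measure M {\<pi> \<in> space M. \<bar>run \<pi> p (q s) - s\<bar> \<le> \<epsilon>}" if "s \<in> {- 1, 1}" for s
  proof -
    have "2 / 3 \<le> measure M {\<pi> \<in> space M.
        \<bar>run \<pi> p (q s) - measure_pmf.expectation (pair_pmf p (q s)) (\<lambda>(a, b). DI a b)\<bar> \<le> \<epsilon>}"
      using M p q[of s] unfolding estimates_def by blast
    then show ?thesis unfolding E[OF that] .
  qed
  obtain \<pi> where \<pi>: "\<pi> \<in> space M"
    "real (card {s \<in> {- 1, 1}. \<bar>run \<pi> p (q s) - s\<bar> \<le> \<epsilon>}) \<ge> 2 / 3 * real (card {- 1, 1 :: real})"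
    by (rule exists_frequent_point[where I = "{- 1, 1 :: real}" and c = "2 / 3"
          and E = "\<lambda>s \<pi>. \<bar>run \<pi> p (q s) - s\<bar> \<le> \<epsilon>"]) (use succ in simp_all)
  let ?G = "{s \<in> {- 1, 1 :: real}. \<bar>run \<pi> p (q s) - s\<bar> \<le> \<epsilon>}"
  have "real (card ?G) > 1" using \<pi>(2) by (simp add: card_insert_if)
  then have "card ?G \<ge> 2" by linarith
  then have "?G = {- 1, 1}" by (intro card_seteq) (auto simp: card_insert_if)
  then have "1 \<in> ?G" "- 1 \<in> ?G" by blast+
  then have "\<bar>run \<pi> p (q 1) - 1\<bar> \<le> \<epsilon>" "\<bar>run \<pi> p (q (- 1)) + 1\<bar> \<le> \<epsilon>" by simp_all
  then have "run \<pi> p (q 1) \<noteq> run \<pi> p (q (- 1))" using \<epsilon> by linarith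
  then have "depth \<pi> \<ge> 1" by (cases \<pi>) auto
  with \<pi>(1) show thesis by (rule that)
qed

text \<open>Bob's row sums are divided by \<open>6 * r = 6 * sqrt m\<close> to fit into
  \<open>[-1, 1]\<close>. Undoing this scales the error to \<open>6 * r * \<epsilon>\<close>, which
  is at most the tolerance 1/80 because \<open>480 = 6 * 80\<close>.\<close>

lemma estimates_DI_depth_ge:
  assumes M: "estimates \<epsilon> (DI_inputs k) (DI_inputs k) DI M"
    and r: "r \<le> 2 ^ k" "r * r \<ge> 32000" "\<epsilon> * (480 * real r) \<le> 1"
  obtains \<pi> where "\<pi> \<in> space M" "real (depth \<pi>) \<ge> real (r * r) / 4096"
proof -
  interpret prob_space M using M by (simp add: estimates_def)
  define m where "m = r * r"
  have r1: "1 \<le> r" using r(2) by (cases r) auto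
  then have rpos: "real r > 0" by simp
  have sq: "sqrt (real m) = real r" by (simp add: m_def)
  define u where "u \<omega> = (\<lambda>b. row_sums m \<omega> b / (6 * real r))" for \<omega>
  have u: "\<bar>u \<omega> b\<bar> \<le> 1" if "\<omega> \<in> bounded_arrays m" "b < r * r" for \<omega> b
    using abs_row_sums_le[OF that(1), of b] that(2) rpos sq by (simp add: u_def m_def)
  define ex where "ex = (\<lambda>(x, \<omega>). measure_pmf.expectation (pair_pmf (alice_pmf k r x) (bob_pmf k r (u \<omega>))) (\<lambda>(a, b). DI a b))"
  have ex: "ex (x, \<omega>) = ip m x (row_sums m \<omega>) / real m / (6 * real r)" if "\<omega> \<in> bounded_arrays m" for x \<omega>
  proof -
    have "ip m x (u \<omega>) = ip m x (row_sums m \<omega>) / (6 * real r)"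
      by (simp add: ip_def u_def sum_divide_distrib)
    then show ?thesis using expectation_DI[OF r1 r(1), of "u \<omega>" x] u[OF that] by (simp add: ex_def flip: m_def)
  qed
  let ?I = "signs m \<times> bounded_arrays m"
  let ?E = "\<lambda>i \<pi>. \<bar>run \<pi> (alice_pmf k r (fst i)) (bob_pmf k r (u (snd i))) - ex i\<bar> \<le> \<epsilon>"
  have m1: "m \<ge> 1" using r1 by (simp add: m_def)
  have "0 < exp (- (real m / 65536)) * real (card (sign_arrays m))" by (simp add: card_sign_arrays)
  then have "real (card (bounded_arrays m)) > 0" using card_bounded_arrays_ge[OF m1] by linarith
  moreover have "card (signs m) > 0" by (simp add: card_signs)
  ultimately have ne: "?I \<noteq> {}" by (auto simp: card_gt_0_iff)
  obtain \<pi> where \<pi>: "\<pi> \<in> space M" "real (card {i \<in> ?I. ?E i \<pi>}) \<ge> 2 / 3 * real (card ?I)"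
  proof (rule exists_frequent_point[where I = ?I and E = ?E and c = "2 / 3"])
    fix i assume "i \<in> ?I"
    then have "set_pmf (alice_pmf k r (fst i)) \<subseteq> DI_inputs k" "set_pmf (bob_pmf k r (u (snd i))) \<subseteq> DI_inputs k"
      using set_alice_pmf[OF r1 r(1), of "fst i"] set_bob_pmf[OF r1 r(1), of "u (snd i)"]
      by (simp_all add: m_def mem_Times_iff)
    then show "2 / 3 \<le> measure M {\<pi> \<in> space M. ?E i \<pi>}"
      using M unfolding estimates_def ex_def by (auto simp: case_prod_beta)
  qed (use ne in auto)
  have "real (depth \<pi>) \<ge> real m / 4096"
  proof (rule depth_ge_of_close[where f = "alice_pmf k r" and g = "\<lambda>\<omega>. bob_pmf k r (u \<omega>)" and h = "\<lambda>t. 6 * real r * t"])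
    show "m \<ge> 32000" using r by (simp add: m_def)
    have "{i \<in> ?I. ?E i \<pi>} \<subseteq> {(x, \<omega>) \<in> ?I. close m (6 * real r * run \<pi> (alice_pmf k r x) (bob_pmf k r (u \<omega>))) x \<omega>}"
    proof clarsimp
      fix x \<omega> assume x: "x \<in> signs m" and \<omega>: "\<omega> \<in> bounded_arrays m"
      define t where "t = run \<pi> (alice_pmf k r x) (bob_pmf k r (u \<omega>))"
      define z where "z = ip m x (row_sums m \<omega>) / real m"
      assume "\<bar>run \<pi> (alice_pmf k r x) (bob_pmf k r (u \<omega>)) - ex (x, \<omega>)\<bar> \<le> \<epsilon>"
      then have "\<bar>t - z / (6 * real r)\<bar> \<le> \<epsilon>" by (simp only: ex[OF \<omega>] t_def z_def)
      then have "6 * real r * \<bar>t - z / (6 * real r)\<bar> \<le> 6 * real r * \<epsilon>"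
        using rpos by (intro mult_left_mono) auto
      moreover have "6 * real r * \<bar>t - z / (6 * real r)\<bar> = \<bar>z - 6 * real r * t\<bar>"
      proof -
        have "6 * real r * \<bar>t - z / (6 * real r)\<bar> = \<bar>6 * real r * (t - z / (6 * real r))\<bar>"
          using rpos by (simp add: abs_mult)
        also have "6 * real r * (t - z / (6 * real r)) = 6 * real r * t - z"
          using rpos by (simp add: right_diff_distrib)
        finally show ?thesis by (simp add: abs_minus_commute)
      qed
      moreover have "6 * real r * \<epsilon> \<le> 1 / 80" using r(3) by (simp add: mult_ac)
      ultimately show "close m (6 * real r * run \<pi> (alice_pmf k r x) (bob_pmf k r (u \<omega>))) x \<omega>"
        unfolding close_def t_def[symmetric] z_def[symmetric] by linarith
    qed
    then have "card {i \<in> ?I. ?E i \<pi>} \<le> card {(x, \<omega>) \<in> ?I. close m (6 * real r * run \<pi> (alice_pmf k r x) (bob_pmf k r (u \<omega>))) x \<omega>}"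
      by (intro card_mono) (auto intro: finite_subset[of _ ?I])
    then show "2 / 3 * real (card (signs m)) * real (card (bounded_arrays m))
        \<le> real (card {(x, \<omega>) \<in> ?I. close m (6 * real r * run \<pi> (alice_pmf k r x) (bob_pmf k r (u \<omega>))) x \<omega>})"
      using \<pi>(2) by (simp add: card_cartesian_product mult.assoc)
  qed
  with \<pi>(1) show thesis using that by (simp add: m_def)
qed

theorem theorem2p8:
  "\<exists>c::real. c > 0 \<and>
     (\<forall>(k::nat) (n::nat) (\<epsilon>::real).
        k \<ge> 2 \<longrightarrow> n = k + 2 ^ k \<longrightarrow> \<epsilon> \<ge> 2 / real n \<longrightarrow> \<epsilon> < 1 \<longrightarrow>
        ereal_of_enat (Rbar \<epsilon> (DI_inputs k) (DI_inputs k) DI) \<ge> ereal (c * (1 / \<epsilon>\<^sup>2)))"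
proof (intro exI[of _ "1 / 10 ^ 10"] conjI allI impI)
  fix k n :: nat and \<epsilon> :: real
  assume n: "n = k + 2 ^ k" and \<epsilon>: "\<epsilon> \<ge> 2 / real n" "\<epsilon> < 1"
  have npos: "real n > 0" using n by (simp add: add_nonneg_pos)
  then have \<epsilon>pos: "\<epsilon> > 0" using \<epsilon>(1) by (meson divide_pos_pos less_le_trans zero_less_numeral)
  define B where "B = 1 / 10 ^ 10 * (1 / \<epsilon>\<^sup>2)"
  have depth: "\<exists>\<pi>\<in>space M. real (depth \<pi>) \<ge> B" if M: "estimates \<epsilon> (DI_inputs k) (DI_inputs k) DI M" for M
  proof -
    define r where "r = nat \<lfloor>1 / (480 * \<epsilon>)\<rfloor>"
    have r: "real r \<le> 1 / (480 * \<epsilon>)" "1 / (480 * \<epsilon>) < real r + 1"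
      using \<epsilon>pos by (simp_all add: r_def)
    show ?thesis
    \<comment> \<open>179 is the least \<open>r\<close> with \<open>r * r >= 32000\<close>.\<close>
    proof (cases "r \<ge> 179")
      case True
      \<comment> \<open>The hypothesis \<open>\<epsilon> >= 2 / n\<close> makes the
        \<open>r \<times> r\<close> matrices fit: \<open>n <= 2 * 2 ^ k\<close> gives
        \<open>1 / \<epsilon> <= 2 ^ k\<close>.\<close>
      have "1 / \<epsilon> \<le> real n / 2" using \<epsilon>(1) \<epsilon>pos npos by (simp add: field_simps)
      moreover have "real n \<le> 2 * 2 ^ k" using n less_exp[of k] by simp
      ultimately have "1 / \<epsilon> \<le> 2 ^ k" by linarith
      moreover have "1 / (480 * \<epsilon>) \<le> 1 / \<epsilon>" using \<epsilon>pos by (simp add: field_simps)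
      ultimately have "real r \<le> 2 ^ k" using r(1) by linarith
      then have rk: "r \<le> 2 ^ k" by (metis of_nat_le_iff of_nat_numeral of_nat_power)
      have rr: "r * r \<ge> 32000" using mult_le_mono[OF True True] by simp
      have r\<epsilon>: "\<epsilon> * (480 * real r) \<le> 1" using r(1) \<epsilon>pos by (simp add: field_simps)
      obtain \<pi> where \<pi>: "\<pi> \<in> space M" "real (depth \<pi>) \<ge> real (r * r) / 4096"
        using estimates_DI_depth_ge[OF M rk rr r\<epsilon>] .
      \<comment> \<open>\<open>r + 1 <= 2 * r\<close>, so rounding down costs at most a factor
        2.\<close>
      have "1 / (960 * \<epsilon>) \<le> real r" using r(2) True by (simp add: field_simps)
      then have "(1 / (960 * \<epsilon>))\<^sup>2 \<le> (real r)\<^sup>2" using \<epsilon>pos by (intro power_mono) auto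
      then have "(1 / \<epsilon>)\<^sup>2 \<le> 921600 * real (r * r)" by (simp add: power2_eq_square)
      moreover have "B = (1 / \<epsilon>)\<^sup>2 / 10000000000" by (simp add: B_def power_divide)
      moreover have "real (r * r) \<ge> 0" by simp
      ultimately have "B \<le> real (r * r) / 4096" by linarith
      then show ?thesis using \<pi> by force
    next
      case False
      obtain \<pi> where \<pi>: "\<pi> \<in> space M" "depth \<pi> \<ge> 1" using estimates_DI_depth_pos[OF M \<epsilon>(2)] .
      \<comment> \<open>Now \<open>1 / \<epsilon> <= 179 * 480 <= 10 ^ 5\<close>, so
        \<open>B <= 1\<close> and a single bit suffices for the bound.\<close>
      have "real r + 1 \<le> 179" using False by simp
      then have "1 / (480 * \<epsilon>) \<le> 179" using r(2) by linarith
      then have "1 / \<epsilon> \<le> 10 ^ 5" using \<epsilon>pos by (simp add: field_simps)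
      then have "(1 / \<epsilon>)\<^sup>2 \<le> (10 ^ 5)\<^sup>2" using \<epsilon>pos by (intro power_mono) auto
      then have "B \<le> 1" by (simp add: B_def power_divide)
      then show ?thesis using \<pi> by force
    qed
  qed
  have "enat (nat \<lceil>B\<rceil>) \<le> Rbar \<epsilon> (DI_inputs k) (DI_inputs k) DI"
    unfolding Rbar_def
  proof (rule INF_greatest)
    fix M assume "M \<in> {M. estimates \<epsilon> (DI_inputs k) (DI_inputs k) DI M}"
    then obtain \<pi> where \<pi>: "\<pi> \<in> space M" "real (depth \<pi>) \<ge> B" using depth by auto
    have "enat (nat \<lceil>B\<rceil>) \<le> enat (depth \<pi>)" using \<pi>(2) by (simp add: ceiling_le_iff)
    also have "\<dots> \<le> worst_case_cost M" unfolding worst_case_cost_def by (rule SUP_upper[OF \<pi>(1)])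
    finally show "enat (nat \<lceil>B\<rceil>) \<le> worst_case_cost M" .
  qed
  then have "ereal_of_enat (enat (nat \<lceil>B\<rceil>)) \<le> ereal_of_enat (Rbar \<epsilon> (DI_inputs k) (DI_inputs k) DI)"
    by (simp only: ereal_of_enat_le_iff)
  moreover have "ereal B \<le> ereal_of_enat (enat (nat \<lceil>B\<rceil>))" by (simp add: of_nat_ceiling)
  ultimately show "ereal (1 / 10 ^ 10 * (1 / \<epsilon>\<^sup>2)) \<le> ereal_of_enat (Rbar \<epsilon> (DI_inputs k) (DI_inputs k) DI)"
    unfolding B_def by (rule order.trans[rotated])
qed simp

end
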